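(* Let $P=(X,\leq)$ be a finite poset such that (i) the cover graph of $P$ has treewidth at most $2$, and (ii) there is a minimal element $a_0\in\min(P)$ such that $a_0<b$ in $P$ for every $b\in\max(P)$. Then the set $\operatorname{MM}(P)$ can be partitioned into $638$ reversible sets.
   Context: The cover graph of $P$ is the graph on $X$ where distinct $x,y$ are adjacent iff one covers the other in $P$ (i.e. they are comparable and the relation is not implied by transitivity through a third element). Treewidth of a graph $G=(V,E)$: the least $t$ such that there are a tree $T$ and nonempty subtrees $T_x$ ($x\in V$) with $V(T_x)\cap V(T_y)\neq\emptyset$ for each edge $xy$, and each node of $T$ lies in at most $t+1$ of the subtrees. $\min(P)$ and $\max(P)$ denote the sets of minimal and maximal elements of $P$. A min-max pair is an ordered pair $(x,y)$ of incomparable elements of $P$ with $x\in\min(P)$ and $y\in\max(P)$; $\operatorname{MM}(P)$ is the set of all min-max pairs. A set $I$ of ordered pairs of incomparable elements of $P$ is reversible if there is a linear extension $L$ of $P$ with $x>y$ in $L$ for every $(x,y)\in I$. *)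

theory Defs
  imports "Graph_Theory.Graph_Theory" "HOL-Library.Disjoint_Sets"
begin

section \<open>Treewidth\<close>

text \<open>
  Finite simple graphs are symmetric digraphs without loops (\<^locale>\<open>pair_graph\<close>).
  The library predicates \<open>forest\<close> and \<open>tree\<close> speak about directed cycles, so they are not
  usable here: an edge of a symmetric digraph is a directed cycle of length 2. In a symmetric digraph
  without loops and parallel arcs the cycles of length at least 3 are exactly the (oriented) cycles
  of the undirected graph. \<^const>\<open>connected\<close> includes that the graph has a vertex.
\<close>

definition undirected_tree :: "'n pair_pre_digraph \<Rightarrow> bool" where
  "undirected_tree T \<longleftrightarrow> pair_graph T \<and> connected (with_proj T) \<and>
     \<not> (\<exists>p. pre_digraph.cycle (with_proj T) p \<and> 3 \<le> length p)"

definition subtree :: "'n pair_pre_digraph \<Rightarrow> 'n pair_pre_digraph \<Rightarrow> bool" where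
  "subtree S T \<longleftrightarrow> undirected_tree S \<and> subgraph (with_proj S) (with_proj T)"

definition tree_decomposition ::
  "'a pair_pre_digraph \<Rightarrow> 'n pair_pre_digraph \<Rightarrow> ('a \<Rightarrow> 'n pair_pre_digraph) \<Rightarrow> nat \<Rightarrow> bool" where
  "tree_decomposition G T S t \<longleftrightarrow>
     undirected_tree T \<and>
     (\<forall>x\<in>pverts G. subtree (S x) T) \<and>
     (\<forall>(x, y)\<in>parcs G. pverts (S x) \<inter> pverts (S y) \<noteq> {}) \<and>
     (\<forall>n\<in>pverts T. card {x \<in> pverts G. n \<in> pverts (S x)} \<le> t + 1)"

text \<open>
  Trees are finite, so it is no restriction that their nodes are natural numbers. For a finite graph
  the set of admissible \<open>t\<close> is nonempty (lemma \<open>tree_decomposition_exists\<close> below);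
  for infinite graphs the definition is not meaningful.
\<close>

definition treewidth :: "'a pair_pre_digraph \<Rightarrow> nat" where
  "treewidth G = (LEAST t. \<exists>(T :: nat pair_pre_digraph) S. tree_decomposition G T S t)"

lemma undirected_tree_singleton: "undirected_tree \<lparr>pverts = {n}, parcs = {}\<rparr>"
proof -
  let ?T = "\<lparr>pverts = {n}, parcs = {}\<rparr>"
  have "pair_graph ?T"
    by unfold_locales (auto simp: symmetric_def sym_def)
  moreover have "connected (with_proj ?T)"
    by (auto simp: connected_def strongly_connected_def mk_symmetric_def reachable_def)
  moreover have "\<not> pre_digraph.cycle (with_proj ?T) p" for p
    by (auto simp: pre_digraph.cycle_def pre_digraph.awalk_def)
  ultimately show ?thesis
    by (auto simp: undirected_tree_def)
qed

lemma tree_decomposition_exists: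
  assumes "finite (pverts G)" and "pair_wf_digraph G"
  shows "\<exists>(T :: nat pair_pre_digraph) S t. tree_decomposition G T S t"
proof -
  let ?T = "\<lparr>pverts = {0 :: nat}, parcs = {}\<rparr>"
  have "subtree ?T ?T"
    using undirected_tree_singleton[of "0 :: nat"]
    by (auto simp: subtree_def subgraph_def compatible_def wf_digraph_def)
  then have "tree_decomposition G ?T (\<lambda>_. ?T) (card (pverts G))"
    by (auto simp: tree_decomposition_def undirected_tree_singleton)
  then show ?thesis by blast
qed

lemma treewidth_le_iff:
  assumes "finite (pverts G)" and "pair_wf_digraph G"
  shows "treewidth G \<le> k \<longleftrightarrow> (\<exists>(T :: nat pair_pre_digraph) S. tree_decomposition G T S k)"
proof
  have "\<exists>(T :: nat pair_pre_digraph) S. tree_decomposition G T S (treewidth G)"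
    unfolding treewidth_def using tree_decomposition_exists[OF assms]
    by (intro LeastI_ex[where P = "\<lambda>t. \<exists>(T :: nat pair_pre_digraph) S. tree_decomposition G T S t"]) blast
  moreover assume "treewidth G \<le> k"
  ultimately show "\<exists>(T :: nat pair_pre_digraph) S. tree_decomposition G T S k"
    unfolding tree_decomposition_def by (meson add_le_mono1 le_trans)
next
  assume "\<exists>(T :: nat pair_pre_digraph) S. tree_decomposition G T S k"
  then show "treewidth G \<le> k"
    unfolding treewidth_def by (rule Least_le)
qed


section \<open>Posets\<close>

text \<open>
  A poset is a carrier \<open>X\<close> with a reflexive order \<open>R\<close> such that
  \<^term>\<open>partial_order_on X R\<close>; the pair \<open>(x, y) \<in> R\<close> means \<open>x \<le> y\<close>.
\<close>

definition strictly_below :: "'a rel \<Rightarrow> 'a \<Rightarrow> 'a \<Rightarrow> bool" where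
  "strictly_below R x y \<longleftrightarrow> (x, y) \<in> R \<and> x \<noteq> y"

definition covered_by :: "'a set \<Rightarrow> 'a rel \<Rightarrow> 'a \<Rightarrow> 'a \<Rightarrow> bool" where
  "covered_by X R x y \<longleftrightarrow> x \<in> X \<and> y \<in> X \<and> strictly_below R x y \<and>
     \<not> (\<exists>z\<in>X. strictly_below R x z \<and> strictly_below R z y)"

definition cover_graph :: "'a set \<Rightarrow> 'a rel \<Rightarrow> 'a pair_pre_digraph" where
  "cover_graph X R =
     \<lparr>pverts = X, parcs = {(x, y). covered_by X R x y \<or> covered_by X R y x}\<rparr>"

lemma pair_graph_cover_graph:
  assumes "finite X"
  shows "pair_graph (cover_graph X R)"
proof -
  have "parcs (cover_graph X R) \<subseteq> X \<times> X"
    by (auto simp: cover_graph_def covered_by_def)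
  then have "finite (parcs (cover_graph X R))"
    using assms finite_subset by blast
  with assms show ?thesis
    by unfold_locales
      (auto simp: cover_graph_def covered_by_def strictly_below_def symmetric_def sym_def)
qed

definition min_elements :: "'a set \<Rightarrow> 'a rel \<Rightarrow> 'a set" where
  "min_elements X R = {x \<in> X. \<not> (\<exists>y\<in>X. strictly_below R y x)}"

definition max_elements :: "'a set \<Rightarrow> 'a rel \<Rightarrow> 'a set" where
  "max_elements X R = {x \<in> X. \<not> (\<exists>y\<in>X. strictly_below R x y)}"

definition incomparable_pairs :: "'a set \<Rightarrow> 'a rel \<Rightarrow> 'a rel" where
  "incomparable_pairs X R = {(x, y) \<in> X \<times> X. (x, y) \<notin> R \<and> (y, x) \<notin> R}"

definition min_max_pairs :: "'a set \<Rightarrow> 'a rel \<Rightarrow> 'a rel" where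
  "min_max_pairs X R =
     {(x, y) \<in> incomparable_pairs X R. x \<in> min_elements X R \<and> y \<in> max_elements X R}"

definition linear_extension :: "'a set \<Rightarrow> 'a rel \<Rightarrow> 'a rel \<Rightarrow> bool" where
  "linear_extension X R L \<longleftrightarrow> linear_order_on X L \<and> R \<subseteq> L"

definition reversible :: "'a set \<Rightarrow> 'a rel \<Rightarrow> 'a rel \<Rightarrow> bool" where
  "reversible X R I \<longleftrightarrow> I \<subseteq> incomparable_pairs X R \<and>
     (\<exists>L. linear_extension X R L \<and> (\<forall>(x, y)\<in>I. strictly_below L y x))"

text \<open>
  The parts are indexed and may be empty (the empty set is reversible), as usual for partitions
  into a given number of sets in dimension theory: a poset with fewer than \<open>m\<close> pairs
  has no partition into exactly \<open>m\<close> nonempty parts.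
\<close>

definition partitionable_into_reversible :: "'a set \<Rightarrow> 'a rel \<Rightarrow> 'a rel \<Rightarrow> nat \<Rightarrow> bool" where
  "partitionable_into_reversible X R M m \<longleftrightarrow>
     (\<exists>I :: nat \<Rightarrow> 'a rel. disjoint_family_on I {..<m} \<and> (\<Union>i<m. I i) = M \<and>
        (\<forall>i<m. reversible X R (I i)))"

end

theory Submission
  imports Defs
begin

text \<open>
  A pair \<open>(a, b)\<close> is joined to \<open>(a', b')\<close> when \<open>a \<le> b'\<close>; a set of pairs is reversible iff this
  relation has no cycle on it. A tree decomposition of width 2 yields an elimination tree in which
  every vertex \<open>v\<close> is inserted between two earlier vertices \<open>l v\<close> (left) and \<open>r v\<close> (right), so that
  every monotone path leaving or entering the set of descendants of \<open>v\<close> runs through \<open>l v\<close> or \<open>r v\<close>.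
  This left-right structure is preserved down the tree: disjoint monotone paths cannot cross.

  Let \<open>u\<close> be the lowest ancestor of \<open>a\<close> with \<open>a\<close> below neither \<open>l u\<close> nor \<open>r u\<close>; everything above
  \<open>a\<close> then descends from \<open>u\<close>. The pairs are classified by whether \<open>b\<close> is no descendant of \<open>u\<close>, a
  right or a left one, and by the order in which \<open>a\<close> and \<open>b\<close> branch off below their lowest common
  ancestor. Within one of these 6 classes, a cycle contained in the descendants of \<open>v\<close> never uses a
  path through \<open>v\<close>, \<open>l v\<close> or \<open>r v\<close>; hence \<open>a\<close> and \<open>b'\<close> always lie below the same child of \<open>v\<close>, and
  the branching order forces the whole cycle below a single child. Descending, no cycle exists.
\<close>


section \<open>Elimination orders from tree decompositions\<close>

lemma connected_imp_rtrancl: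
  assumes "pair_graph T" and "connected (with_proj T)" and "u \<in> pverts T" and "v \<in> pverts T"
  shows "(u, v) \<in> (parcs T)\<^sup>*"
proof -
  interpret pair_graph T by fact
  have "u \<rightarrow>\<^sup>*\<^bsub>mk_symmetric T\<^esub> v"
    using assms by (auto simp: connected_def strongly_connected_def)
  then have "u \<rightarrow>\<^sup>*\<^bsub>T\<^esub> v"
    using reachable_mk_symmetric_eq sym_arcs by blast
  then show ?thesis
    unfolding reachable_def by (auto simp: rtrancl_on_rtranclI arcs_ends_conv)
qed

text \<open>A path from \<open>m\<close> to \<open>n\<close> avoiding the edge has at least two
  arcs, so closing it with \<open>(n, m)\<close> would give a cycle of length at least 3.\<close>

lemma undirected_tree_bridge:
  assumes T: "undirected_tree T" and mn: "(m, n) \<in> parcs T"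
  shows "(m, n) \<notin> (parcs T - {(m, n), (n, m)})\<^sup>*"
proof
  assume *: "(m, n) \<in> (parcs T - {(m, n), (n, m)})\<^sup>*"
  interpret pair_graph T using T by (simp add: undirected_tree_def)
  let ?T' = "\<lparr>pverts = pverts T, parcs = parcs T - {(m, n), (n, m)}\<rparr>"
  interpret T': pair_wf_digraph ?T'
    by unfold_locales (auto dest: in_arcsD1 in_arcsD2)
  have m: "m \<in> pverts T" and n: "n \<in> pverts T" and "m \<noteq> n"
    using mn by (auto dest: in_arcsD1 in_arcsD2 no_loops')
  have "m \<rightarrow>\<^sup>*\<^bsub>?T'\<^esub> n"
    using * m T'.reachable_conv' by (simp add: arcs_ends_conv)
  then obtain p where p: "T'.apath m p n"
    using T'.reachable_apath by blast
  then have "awalk m p n"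
    unfolding T'.apath_def T'.awalk_def awalk_def by auto
  moreover have "awalk n [(n, m)] m"
    using mn n arcs_symmetric by (auto simp: awalk_def)
  ultimately have aw: "awalk m (p @ [(n, m)]) m"
    by (rule awalk_appendI)
  have len: "2 \<le> length p"
  proof -
    have "p \<noteq> []" using p \<open>m \<noteq> n\<close> by (auto simp: T'.apath_def T'.awalk_def)
    moreover have "length p \<noteq> 1"
    proof
      assume "length p = 1"
      then obtain e where "p = [e]" by (auto simp: length_Suc_conv)
      then show False using p by (cases e) (auto simp: T'.apath_def T'.awalk_def)
    qed
    ultimately show ?thesis by (cases p) (auto simp: Suc_le_eq)
  qed
  have "distinct (pawalk_verts m p)" using p by (simp add: T'.apath_def)
  moreover have "tl (awalk_verts m (p @ [(n, m)])) = tl (pawalk_verts m p) @ [m]"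
    using awalk_verts_append[OF aw] \<open>awalk m p n\<close> by (cases p) (auto simp: awalk_def)
  moreover have "pawalk_verts m p = m # tl (pawalk_verts m p)"
    using \<open>awalk m p n\<close> len by (cases p) (auto simp: awalk_def)
  ultimately have "distinct (tl (awalk_verts m (p @ [(n, m)])))"
    by (metis distinct.simps(2) distinct_append distinct_singleton disjoint_insert(2)
        inf_bot_right list.set(1) list.set(2))
  with aw have "cycle (p @ [(n, m)])" by (auto simp: cycle_def)
  moreover have "3 \<le> length (p @ [(n, m)])" using len by simp
  ultimately show False using T unfolding undirected_tree_def by blast
qed

text \<open>Take \<open>d\<close> to be the distance from \<open>r\<close> and
  \<open>\<pi> n\<close> a neighbour of \<open>n\<close> one step closer. If some edge joined no
  node to its parent, both its ends could climb to \<open>r\<close> without it, contradicting that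
  every edge is a bridge.\<close>

lemma undirected_tree_rooted:
  assumes T: "undirected_tree T" and r: "r \<in> pverts T"
  shows "\<exists>(d :: 'n \<Rightarrow> nat) \<pi>. d r = 0 \<and>
    (\<forall>n\<in>pverts T. n \<noteq> r \<longrightarrow> \<pi> n \<in> pverts T \<and> d n = Suc (d (\<pi> n))) \<and>
    (\<forall>(m, n)\<in>parcs T. (m \<noteq> r \<and> \<pi> m = n) \<or> (n \<noteq> r \<and> \<pi> n = m))"
proof -
  interpret pair_graph T using T by (simp add: undirected_tree_def)
  define d where "d n = (LEAST k. (r, n) \<in> parcs T ^^ k)" for n
  have ex: "\<exists>k. (r, n) \<in> parcs T ^^ k" if "n \<in> pverts T" for n
    using connected_imp_rtrancl[OF _ _ r that] T rtrancl_imp_relpow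
    by (fastforce simp: undirected_tree_def)
  have d_path: "(r, n) \<in> parcs T ^^ d n" if "n \<in> pverts T" for n
    unfolding d_def using ex[OF that] by (rule LeastI_ex)
  have d_le: "d n \<le> k" if "(r, n) \<in> parcs T ^^ k" for n k
    unfolding d_def using that by (rule Least_le)
  have d_r: "d r = 0" using d_le[of r 0] by simp
  have "\<exists>m. (m, n) \<in> parcs T \<and> d n = Suc (d m)" if n: "n \<in> pverts T" "n \<noteq> r" for n
  proof -
    obtain k where k: "d n = Suc k"
      using d_path[OF n(1)] n(2) by (cases "d n") auto
    then obtain m where m: "(r, m) \<in> parcs T ^^ k" "(m, n) \<in> parcs T"
      using d_path[OF n(1)] by auto
    have "d m \<le> k" by (rule d_le) fact
    moreover have "(r, n) \<in> parcs T ^^ Suc (d m)"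
      using d_path[of m] m(2) in_arcsD1 by auto
    then have "d n \<le> Suc (d m)" by (rule d_le)
    ultimately show ?thesis using m(2) k by auto
  qed
  then obtain \<pi> where \<pi>: "\<And>n. n \<in> pverts T \<Longrightarrow> n \<noteq> r \<Longrightarrow> (\<pi> n, n) \<in> parcs T \<and> d n = Suc (d (\<pi> n))"
    by metis
  have edge: "(m \<noteq> r \<and> \<pi> m = n) \<or> (n \<noteq> r \<and> \<pi> n = m)" if mn: "(m, n) \<in> parcs T" for m n
  proof (rule ccontr)
    assume neg: "\<not> ?thesis"
    let ?A = "parcs T - {(m, n), (n, m)}"
    have to_r: "(x, r) \<in> ?A\<^sup>*" if "x \<in> pverts T" for x
      using that
    proof (induction "d x" arbitrary: x rule: less_induct)
      case less
      show ?case
      proof (cases "x = r")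
        case False
        have "(x, \<pi> x) \<in> parcs T"
          using \<pi>[OF less.prems False] arcs_symmetric by auto
        moreover have "(x, \<pi> x) \<notin> {(m, n), (n, m)}" using neg False by auto
        moreover have "(\<pi> x, r) \<in> ?A\<^sup>*"
          using \<pi>[OF less.prems False] in_arcsD1 by (intro less.hyps) auto
        ultimately show ?thesis by (meson DiffI converse_rtrancl_into_rtrancl)
      qed simp
    qed
    have "sym ?A" using arcs_symmetric by (auto simp: sym_def)
    then have "sym (?A\<^sup>*)" by (rule sym_rtrancl)
    then have "(r, n) \<in> ?A\<^sup>*" using to_r[of n] mn in_arcsD2 by (auto dest: symD)
    then have "(m, n) \<in> ?A\<^sup>*" using to_r[of m] mn in_arcsD1 by auto
    then show False using undirected_tree_bridge[OF T mn] by blast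
  qed
  show ?thesis
    using d_r \<pi> edge in_arcsD1 by (intro exI[of _ d] exI[of _ \<pi>]) blast
qed

text \<open>\<open>N y\<close> plays the role of the earlier neighbours of \<open>y\<close> in a
  chordal supergraph of \<open>G\<close>: they form a clique, so \<open>idx\<close> read backwards
  is a perfect elimination ordering. The first vertex \<open>z\<close> will become the root.\<close>

definition elimination_order ::
  "'a pair_pre_digraph \<Rightarrow> nat \<Rightarrow> 'a \<Rightarrow> ('a \<Rightarrow> nat) \<Rightarrow> ('a \<Rightarrow> 'a set) \<Rightarrow> bool" where
  "elimination_order G k z idx N \<longleftrightarrow> inj_on idx (pverts G) \<and> z \<in> pverts G \<and>
     (\<forall>x\<in>pverts G. idx z \<le> idx x) \<and>
     (\<forall>y\<in>pverts G. N y \<subseteq> {x \<in> pverts G. idx x < idx y} \<and> card (N y) \<le> k) \<and>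
     (\<forall>y\<in>pverts G. \<forall>x\<in>N y. \<forall>x'\<in>N y. idx x < idx x' \<longrightarrow> x \<in> N x') \<and>
     (\<forall>x\<in>pverts G. \<forall>y\<in>pverts G. (x, y) \<in> parcs G \<longrightarrow> idx x < idx y \<longrightarrow> x \<in> N y)"

text \<open>Order the vertices by the depth of the topmost node \<open>t x\<close> of their
  subtrees, and let \<open>N y\<close> consist of the earlier vertices whose subtrees meet that of
  \<open>y\<close>. All these subtrees contain \<open>t y\<close>, which bounds their number by the
  width and makes them meet pairwise.\<close>

lemma tree_decomposition_elimination_order:
  fixes G :: "'a pair_pre_digraph" and T :: "'n pair_pre_digraph"
  assumes td: "tree_decomposition G T S k" and fin: "finite (pverts G)" and z: "z \<in> pverts G"
  shows "\<exists>idx N. elimination_order G k z idx N"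
proof -
  let ?V = "pverts G" and ?S = "\<lambda>x. pverts (S x)"
  have T: "undirected_tree T" using td by (simp add: tree_decomposition_def)
  interpret pair_graph T using T by (simp add: undirected_tree_def)
  have S: "pair_graph (S x)" "Digraph_Component.connected (with_proj (S x))" "?S x \<noteq> {}"
    "?S x \<subseteq> pverts T" "parcs (S x) \<subseteq> parcs T" if "x \<in> ?V" for x
    using td that
    by (auto simp: tree_decomposition_def subtree_def undirected_tree_def subgraph_def
        connected_def strongly_connected_def)
  \<comment> \<open>Rooting inside the subtree of \<open>z\<close> gives \<open>z\<close> depth 0,
    so that it can come first.\<close>
  obtain r where r: "r \<in> ?S z" using S(3)[OF z] by blast
  then have "r \<in> pverts T" using S(4)[OF z] by blast
  then obtain d :: "'n \<Rightarrow> nat" and \<pi> where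
    d_r: "d r = 0" and
    \<pi>': "\<forall>n\<in>pverts T. n \<noteq> r \<longrightarrow> \<pi> n \<in> pverts T \<and> d n = Suc (d (\<pi> n))" and
    edge': "\<forall>(m, n)\<in>parcs T. (m \<noteq> r \<and> \<pi> m = n) \<or> (n \<noteq> r \<and> \<pi> n = m)"
    using undirected_tree_rooted[OF T] by blast
  have \<pi>: "\<pi> n \<in> pverts T \<and> d n = Suc (d (\<pi> n))" if "n \<in> pverts T" "n \<noteq> r" for n
    using bspec[OF \<pi>' that(1)] that(2) by simp
  have edge: "(m \<noteq> r \<and> \<pi> m = n) \<or> (n \<noteq> r \<and> \<pi> n = m)" if "(m, n) \<in> parcs T" for m n
    using bspec[OF edge' that] by simp
  define U where "U = {(c, \<pi> c) | c. c \<in> pverts T \<and> c \<noteq> r}"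
  have U_depth: "m = n \<or> d n < d m" if "(m, n) \<in> U\<^sup>*" for m n
    using that
  proof induction
    case (step n n')
    then have "d n' < d n" using \<pi> by (auto simp: U_def)
    then show ?case using step.IH by auto
  qed simp
  \<comment> \<open>A walk inside the subtree that starts at \<open>n\<close> can never step up from
    \<open>n\<close>, so it stays below \<open>n\<close>.\<close>
  have below: "(m, n) \<in> U\<^sup>*"
    if x: "x \<in> ?V" and n: "n \<in> ?S x" and top: "n = r \<or> \<pi> n \<notin> ?S x" and m: "m \<in> ?S x" for x n m
  proof -
    have "(n, m) \<in> (parcs (S x))\<^sup>*" by (rule connected_imp_rtrancl[OF S(1)[OF x] S(2)[OF x] n m])
    then show ?thesis
    proof induction
      case (step m m')
      interpret Sx: pair_graph "S x" using S(1)[OF x] .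
      have mm': "m \<in> ?S x" "m' \<in> ?S x" "m \<in> pverts T" "m' \<in> pverts T" "(m, m') \<in> parcs T"
        using step.hyps(2) S(4,5)[OF x] Sx.in_arcsD1 Sx.in_arcsD2 by auto
      from edge[OF mm'(5)] show ?case
      proof
        assume up: "m \<noteq> r \<and> \<pi> m = m'"
        with top mm' have "m \<noteq> n" by auto
        with step.IH obtain c where "(m, c) \<in> U" "(c, n) \<in> U\<^sup>*"
          by (meson converse_rtranclE)
        with up show ?thesis by (auto simp: U_def)
      next
        assume "m' \<noteq> r \<and> \<pi> m' = m"
        then have "(m', m) \<in> U" using mm' by (auto simp: U_def)
        then show ?thesis using step.IH by (rule converse_rtrancl_into_rtrancl)
      qed
    qed simp
  qed
  have "\<exists>n\<in>?S x. \<forall>n'\<in>?S x. d n \<le> d n'" if "x \<in> ?V" for x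
    using S(3)[OF that] ex_has_least_nat[of "\<lambda>n. n \<in> ?S x" _ d] by blast
  then obtain t where t: "\<And>x. x \<in> ?V \<Longrightarrow> t x \<in> ?S x"
    and t_min: "\<And>x n. x \<in> ?V \<Longrightarrow> n \<in> ?S x \<Longrightarrow> d (t x) \<le> d n"
    by metis
  have climb: "n \<noteq> r \<and> \<pi> n \<in> ?S x" if "x \<in> ?V" "n \<in> ?S x" "n \<noteq> t x" for x n
    using below[OF that(1,2) _ t[OF that(1)]] U_depth t_min[OF that(1,2)] that(3) by fastforce
  \<comment> \<open>Climb from a common node towards \<open>t y\<close>, staying in both subtrees:
    strictly below \<open>t y\<close> the node cannot be \<open>t x\<close>, whose depth is at most
    that of \<open>t y\<close>.\<close>
  have top_mem: "t y \<in> ?S x"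
    if xy: "x \<in> ?V" "y \<in> ?V" "d (t x) \<le> d (t y)" and n: "n \<in> ?S x" "n \<in> ?S y" for x y n
    using n
  proof (induction "d n" arbitrary: n rule: less_induct)
    case less
    show ?case
    proof (cases "n = t y")
      case False
      have n: "n \<noteq> r" "\<pi> n \<in> ?S y" using climb[OF xy(2) less.prems(2) False] by auto
      have dn: "d n = Suc (d (\<pi> n))" using \<pi> n(1) less.prems(1) S(4)[OF xy(1)] by auto
      then have "n \<noteq> t x" using t_min[OF xy(2) n(2)] xy(3) by auto
      then have "\<pi> n \<in> ?S x" using climb[OF xy(1) less.prems(1)] by simp
      then show ?thesis using less.hyps[of "\<pi> n"] n(2) dn by simp
    qed (use less.prems in simp)
  qed
  obtain g where g: "inj_on g ?V" "g ` ?V \<subseteq> {..<card ?V}"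
    using ex_bij_betw_finite_nat[OF fin] by (auto simp: bij_betw_def atLeast0LessThan)
  define M where "M = Suc (card ?V)"
  define h where "h x = (if x = z then 0 else Suc (g x))" for x
  \<comment> \<open>A lexicographic order written as a number: depth first, then the tie-breaker
    \<open>h\<close>, which is smaller than \<open>M\<close> and vanishes only at
    \<open>z\<close>.\<close>
  define idx where "idx x = d (t x) * M + h x" for x
  have h: "h x < M" if "x \<in> ?V" for x using g(2) that by (auto simp: h_def M_def)
  have idx_div: "idx x div M = d (t x)" and idx_mod: "idx x mod M = h x" if "x \<in> ?V" for x
    using h[OF that] by (auto simp: idx_def)
  have idx_inj: "inj_on idx ?V"
  proof (rule inj_onI)
    fix x y assume "x \<in> ?V" "y \<in> ?V" "idx x = idx y"
    then have "h x = h y" using idx_mod by metis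
    then show "x = y" using g(1) \<open>x \<in> ?V\<close> \<open>y \<in> ?V\<close>
      by (auto simp: h_def inj_on_def split: if_splits)
  qed
  have idx_le: "d (t x) \<le> d (t y)" if "x \<in> ?V" "y \<in> ?V" "idx x < idx y" for x y
    using div_le_mono[of "idx x" "idx y" M] idx_div that by simp
  have idx_z: "idx z = 0" using t_min[OF z r] d_r by (simp add: idx_def h_def)
  define N where "N y = {x \<in> ?V. idx x < idx y \<and> ?S x \<inter> ?S y \<noteq> {}}" for y
  have N_top: "t y \<in> ?S x" if "y \<in> ?V" "x \<in> N y" for x y
    using that idx_le top_mem unfolding N_def by blast
  have card_le: "card (N y) \<le> k" if y: "y \<in> ?V" for y
  proof -
    have "card (insert y (N y)) \<le> card {x \<in> ?V. t y \<in> ?S x}"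
      by (rule card_mono) (use fin N_top[OF y] y t in \<open>auto simp: N_def\<close>)
    also have "card {x \<in> ?V. t y \<in> ?S x} \<le> k + 1"
      using td t[OF y] S(4)[OF y] by (auto simp: tree_decomposition_def)
    finally have "card (insert y (N y)) \<le> k + 1" .
    moreover have "y \<notin> N y" "finite (N y)" using fin by (auto simp: N_def)
    ultimately show ?thesis by simp
  qed
  have clique: "x \<in> N x'" if "y \<in> ?V" "x \<in> N y" "x' \<in> N y" "idx x < idx x'" for x x' y
    using that(2-4) N_top[OF that(1,2)] N_top[OF that(1,3)] by (auto simp: N_def)
  have edges: "x \<in> N y" if "(x, y) \<in> parcs G" "x \<in> ?V" "y \<in> ?V" "idx x < idx y" for x y
    using that td by (auto simp: N_def tree_decomposition_def)
  have "elimination_order G k z idx N"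
    unfolding elimination_order_def
  proof (intro conjI ballI impI)
    show "N y \<subseteq> {x \<in> ?V. idx x < idx y}" for y by (auto simp: N_def)
    show "x \<in> N x'" if "y \<in> ?V" "x \<in> N y" "x' \<in> N y" "idx x < idx x'" for x x' y
      using that by (rule clique)
    show "x \<in> N y" if "x \<in> ?V" "y \<in> ?V" "(x, y) \<in> parcs G" "idx x < idx y" for x y
      using that(3,1,2,4) by (rule edges)
  qed (use idx_inj z card_le in \<open>simp_all add: idx_z\<close>)
  then show ?thesis by blast
qed

section \<open>Left and right gates for width two\<close>

lemma ex_maximal_value:
  fixes f :: "'a \<Rightarrow> nat"
  assumes "finite A" and "A \<noteq> {}"
  obtains q where "q \<in> A" and "\<And>x. x \<in> A \<Longrightarrow> f x \<le> f q"
proof -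
  have "Max (f ` A) \<in> f ` A" using assms by (intro Max_in) auto
  then obtain q where q: "q \<in> A" "Max (f ` A) = f q" by (rule imageE)
  have "f x \<le> f q" if "x \<in> A" for x
    unfolding q(2)[symmetric] using assms(1) that by (intro Max_ge) auto
  with q(1) show thesis by (rule that)
qed

text \<open>Vertices are inserted one by one in the order of \<open>idx\<close>. The last member
  \<open>q\<close> of \<open>N v\<close> serves as parent of \<open>v\<close>; any other member is a
  gate of \<open>q\<close> by the clique property, and there is at most one. So \<open>v\<close>
  goes between \<open>l q\<close> and \<open>q\<close> or between \<open>q\<close> and
  \<open>r q\<close>. If \<open>N v\<close> is empty, \<open>z\<close> serves as
  \<open>q\<close>.\<close>

lemma ex_gates:
  assumes ord: "elimination_order G 2 z idx N" and fin: "finite (pverts G)"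
  shows "\<exists>l r p. l z = z \<and> r z = z \<and> (\<forall>v\<in>pverts G - {z}. p v \<in> pverts G \<and> idx (p v) < idx v \<and>
    N v \<subseteq> {l v, r v} \<and> (l v = l (p v) \<and> r v = p v \<or> l v = p v \<and> r v = r (p v)))"
proof -
  define V where "V = pverts G"
  have inj: "inj_on idx V" and z: "z \<in> V" "\<And>x. x \<in> V \<Longrightarrow> idx z \<le> idx x"
    and N: "\<And>y. y \<in> V \<Longrightarrow> N y \<subseteq> {x \<in> V. idx x < idx y} \<and> card (N y) \<le> 2"
    and clique: "\<And>x x' y. y \<in> V \<Longrightarrow> x \<in> N y \<Longrightarrow> x' \<in> N y \<Longrightarrow> idx x < idx x' \<Longrightarrow> x \<in> N x'"
    and fin: "finite V"
    using ord fin by (simp_all add: elimination_order_def V_def)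
  have "\<exists>l r p. l z = z \<and> r z = z \<and> (\<forall>v\<in>V - {z}. idx v < n \<longrightarrow> p v \<in> V \<and> idx (p v) < idx v \<and>
    N v \<subseteq> {l v, r v} \<and> (l v = l (p v) \<and> r v = p v \<or> l v = p v \<and> r v = r (p v)))" for n
  proof (induction n)
    case 0
    show ?case by (intro exI[of _ "\<lambda>_. z"]) simp
  next
    case (Suc n)
    then obtain l r p where lz: "l z = z" "r z = z"
      and *: "\<forall>v\<in>V - {z}. idx v < n \<longrightarrow> p v \<in> V \<and> idx (p v) < idx v \<and>
        N v \<subseteq> {l v, r v} \<and> (l v = l (p v) \<and> r v = p v \<or> l v = p v \<and> r v = r (p v))"
      by blast
    have lrp: "p v \<in> V \<and> idx (p v) < idx v \<and>
        N v \<subseteq> {l v, r v} \<and> (l v = l (p v) \<and> r v = p v \<or> l v = p v \<and> r v = r (p v))"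
      if "v \<in> V" "v \<noteq> z" "idx v < n" for v
      using bspec[OF *, of v] that by simp
    show ?case
    proof (cases "\<exists>v\<in>V - {z}. idx v = n")
      case False
      then show ?thesis using lz lrp
        by (intro exI[of _ l] exI[of _ r] exI[of _ p]) (auto simp: less_Suc_eq)
    next
      case True
      then obtain v where v: "v \<in> V" "v \<noteq> z" "idx v = n" by blast
      have "\<exists>q\<in>V. idx q < n \<and> (N v \<subseteq> {l q, q} \<or> N v \<subseteq> {q, r q})"
      proof (cases "N v = {}")
        case True
        have "idx z < n" using z v inj by (metis inj_onD le_neq_implies_less)
        with True z(1) show ?thesis by blast
      next
        case False
        have fN: "finite (N v)" using N[OF v(1)] fin by (auto intro: finite_subset)
        obtain q where q: "q \<in> N v" "\<And>x. x \<in> N v \<Longrightarrow> idx x \<le> idx q"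
          using ex_maximal_value[OF fN False, of idx] by blast
        have qV: "q \<in> V" "idx q < n" using q N[OF v(1)] v(3) by auto
        have "x \<in> {l q, r q}" if x: "x \<in> N v" "x \<noteq> q" for x
        proof -
          have "x \<in> V" using x N[OF v(1)] by auto
          with x q qV inj have "idx x < idx q" by (metis inj_onD le_neq_implies_less)
          moreover from this have "q \<noteq> z" using z(2)[OF \<open>x \<in> V\<close>] by auto
          ultimately show ?thesis using clique[OF v(1) x(1) q(1)] lrp[of q] qV by blast
        qed
        moreover have "card (N v - {q}) \<le> 1"
          unfolding card_Diff_singleton[OF q(1)] using conjunct2[OF N[OF v(1)]] by linarith
        then have "x = y" if "x \<in> N v - {q}" "y \<in> N v - {q}" for x y
          using that fN by (metis card_le_Suc0_iff_eq One_nat_def finite_Diff)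
        ultimately have "N v \<subseteq> {l q, q} \<or> N v \<subseteq> {q, r q}" by blast
        with qV show ?thesis by blast
      qed
      then obtain q where q: "q \<in> V" "idx q < n" and Nq: "N v \<subseteq> {l q, q} \<or> N v \<subseteq> {q, r q}"
        by blast
      define lv where "lv = (if N v \<subseteq> {l q, q} then l q else q)"
      define rv where "rv = (if N v \<subseteq> {l q, q} then q else r q)"
      have eq: "u = v" if "u \<in> V" "idx u = n" for u using that v inj by (auto dest: inj_onD)
      have "q \<noteq> v" using q v by auto
      define l' where "l' = l(v := lv)"
      define r' where "r' = r(v := rv)"
      define p' where "p' = p(v := q)"
      have "p' u \<in> V \<and> idx (p' u) < idx u \<and> N u \<subseteq> {l' u, r' u} \<and>
        (l' u = l' (p' u) \<and> r' u = p' u \<or> l' u = p' u \<and> r' u = r' (p' u))"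
        if u: "u \<in> V" "u \<noteq> z" "idx u < Suc n" for u
      proof (cases "u = v")
        case True
        then show ?thesis using q v(3) \<open>q \<noteq> v\<close> Nq
          by (simp add: l'_def r'_def p'_def lv_def rv_def) blast
      next
        case False
        then have "idx u < n" using u eq by (auto simp: less_Suc_eq)
        note * = lrp[OF u(1,2) this]
        then have "p u \<noteq> v" using \<open>idx u < n\<close> v(3) by auto
        then show ?thesis using * False by (simp add: l'_def r'_def p'_def)
      qed
      moreover have "l' z = z" "r' z = z" using lz v(2) by (simp_all add: l'_def r'_def)
      ultimately show ?thesis by (intro exI[of _ l'] exI[of _ r'] exI[of _ p']) simp
    qed
  qed
  note this[of "Suc (Max (idx ` V))"]
  moreover have "idx v < Suc (Max (idx ` V))" if "v \<in> V" for v
    using fin that by (simp add: less_Suc_eq_le)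
  ultimately show ?thesis unfolding V_def by (meson DiffD1)
qed


section \<open>Reversible sets and alternating cycles\<close>

text \<open>The cycles of this relation on pairs are the alternating cycles of dimension
  theory.\<close>

definition alternation :: "'a rel \<Rightarrow> 'a rel \<Rightarrow> ('a \<times> 'a) rel" where
  "alternation R I = {((a, b), (a', b')). (a, b) \<in> I \<and> (a', b') \<in> I \<and> (a, b') \<in> R}"

text \<open>Sort lexicographically by \<open>K\<close>, then by the size of the down-set, which
  grows strictly along \<open>R\<close>, then by an injective numbering that breaks the remaining
  ties.\<close>

lemma ex_linear_extension_of_potential:
  fixes K :: "'a \<Rightarrow> nat"
  assumes fin: "finite X" and po: "partial_order_on X R"
    and mono: "\<And>x y. (x, y) \<in> R \<Longrightarrow> K x \<le> K y"
  shows "\<exists>L. linear_extension X R L \<and> (\<forall>x\<in>X. \<forall>y\<in>X. K x < K y \<longrightarrow> strictly_below L x y)"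
proof -
  have R: "refl_on X R" "trans R" "antisym R" "R \<subseteq> X \<times> X"
    using po by (auto simp: partial_order_on_def preorder_on_def)
  obtain g :: "'a \<Rightarrow> nat" where g: "inj_on g X"
    using ex_bij_betw_finite_nat[OF fin] by (auto simp: bij_betw_def)
  define h where "h x = card {z \<in> X. (z, x) \<in> R}" for x
  have h_mono: "h x < h y" if "(x, y) \<in> R" "x \<noteq> y" for x y
    unfolding h_def
  proof (rule psubset_card_mono)
    have "(y, x) \<notin> R" using that R(3) by (auto dest: antisymD)
    moreover have "(y, y) \<in> R" "y \<in> X" using that R(1,4) by (auto dest: refl_onD)
    ultimately show "{z \<in> X. (z, x) \<in> R} \<subset> {z \<in> X. (z, y) \<in> R}"
      using that R(2) by (auto dest: transD)
  qed (use fin in simp)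
  define lt where "lt x y \<longleftrightarrow> K x < K y \<or> K x = K y \<and> (h x < h y \<or> h x = h y \<and> g x < g y)" for x y
  define L where "L = {(x, y) \<in> X \<times> X. x = y \<or> lt x y}"
  have "linear_order_on X L"
    unfolding linear_order_on_def partial_order_on_def preorder_on_def
  proof (intro conjI)
    show "L \<subseteq> X \<times> X" "refl_on X L" by (auto simp: L_def refl_on_def)
    show "trans L" "antisym L" by (auto simp: L_def lt_def trans_def antisym_def)
    have "lt x y \<or> lt y x" if "x \<in> X" "y \<in> X" "x \<noteq> y" for x y
      using that g unfolding lt_def inj_on_def by (metis linorder_neqE_nat)
    then show "total_on X L" by (auto simp: L_def total_on_def)
  qed
  moreover have "lt x y" if "(x, y) \<in> R" "x \<noteq> y" for x y
    using mono[OF that(1)] h_mono[OF that] by (auto simp: lt_def)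
  then have "R \<subseteq> L" using R(4) by (auto simp: L_def)
  moreover have "strictly_below L x y" if "x \<in> X" "y \<in> X" "K x < K y" for x y
    using that by (auto simp: strictly_below_def L_def lt_def)
  ultimately show ?thesis unfolding linear_extension_def by blast
qed

text \<open>
  The potential of \<open>x\<close> is one more than the largest rank of a pair \<open>(a, b)\<close> with \<open>a \<le> x\<close>, where the
  rank counts the predecessors in the alternation relation; it drops from \<open>a\<close> to \<open>b\<close>.
\<close>
lemma reversible_if_acyclic_alternation:
  assumes fin: "finite X" and po: "partial_order_on X R" and I: "I \<subseteq> incomparable_pairs X R"
    and ac: "acyclic (alternation R I)"
  shows "reversible X R I"
proof -
  let ?E = "alternation R I"
  have R: "refl_on X R" "trans R" using po by (auto simp: partial_order_on_def preorder_on_def)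
  have IX: "I \<subseteq> X \<times> X" using I by (auto simp: incomparable_pairs_def)
  have finI: "finite I" using IX fin finite_subset by blast
  define \<rho> where "\<rho> i = card {k. (k, i) \<in> ?E\<^sup>+}" for i
  have EI: "(k, i) \<in> ?E\<^sup>+ \<Longrightarrow> k \<in> I" for k i
    by (induction rule: converse_trancl_induct) (auto simp: alternation_def)
  have \<rho>_less: "\<rho> i < \<rho> j" if "(i, j) \<in> ?E" for i j
    unfolding \<rho>_def
  proof (rule psubset_card_mono)
    show "finite {k. (k, j) \<in> ?E\<^sup>+}" by (rule finite_subset[OF _ finI]) (use EI in blast)
    have "(i, i) \<notin> ?E\<^sup>+" using ac unfolding acyclic_def by blast
    then show "{k. (k, i) \<in> ?E\<^sup>+} \<subset> {k. (k, j) \<in> ?E\<^sup>+}"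
      using that by (blast intro: trancl_into_trancl)
  qed
  define A where "A x = {Suc (\<rho> (a, b)) | a b. (a, b) \<in> I \<and> (a, x) \<in> R}" for x
  define K where "K x = Max (insert 0 (A x))" for x
  have finA: "finite (A x)" for x
    by (rule finite_subset[OF _ finite_imageI[OF finI]]) (auto simp: A_def image_def)
  have K_mono: "K x \<le> K y" if "(x, y) \<in> R" for x y
  proof -
    have "A x \<subseteq> A y" using that R(2) by (auto simp: A_def dest: transD)
    then show ?thesis unfolding K_def using finA by (intro Max_mono) auto
  qed
  obtain L where L: "linear_extension X R L"
    "\<forall>x\<in>X. \<forall>y\<in>X. K x < K y \<longrightarrow> strictly_below L x y"
    using ex_linear_extension_of_potential[of X R K, OF fin po K_mono] by blast
  have "K b < K a" if ab: "(a, b) \<in> I" for a b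
  proof -
    have "(a, a) \<in> R" using ab IX R(1) by (auto dest: refl_onD)
    then have "Suc (\<rho> (a, b)) \<le> K a"
      unfolding K_def using ab finA by (intro Max_ge) (auto simp: A_def)
    \<comment> \<open>Every pair counted at \<open>b\<close> has an arc to \<open>(a, b)\<close>,
      hence a smaller rank.\<close>
    moreover have "n \<le> \<rho> (a, b)" if "n \<in> insert 0 (A b)" for n
      using that ab \<rho>_less[of _ "(a, b)"] by (auto simp: A_def alternation_def Suc_le_eq)
    then have "K b \<le> \<rho> (a, b)" unfolding K_def using finA by (intro Max.boundedI) auto
    ultimately show ?thesis by simp
  qed
  with L(2) IX have "\<forall>(a, b)\<in>I. strictly_below L b a" by blast
  with I L(1) show ?thesis unfolding reversible_def by blast
qed

text \<open>The strong component of a vertex on a cycle works: intermediate vertices of a walk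
  between two of its members belong to it as well.\<close>

lemma not_acyclic_imp_strongly_connected:
  assumes "\<not> acyclic E"
  obtains C where "C \<noteq> {}" and "\<And>x y. x \<in> C \<Longrightarrow> y \<in> C \<Longrightarrow> (x, y) \<in> (E \<inter> C \<times> C)\<^sup>+"
proof -
  obtain i where i: "(i, i) \<in> E\<^sup>+" using assms by (auto simp: acyclic_def)
  define C where "C = {j. (i, j) \<in> E\<^sup>+ \<and> (j, i) \<in> E\<^sup>+}"
  have "(x, y) \<in> (E \<inter> C \<times> C)\<^sup>+" if "x \<in> C" "y \<in> C" for x y
  proof -
    have "(x, y) \<in> E\<^sup>+" using that by (auto simp: C_def)
    then show ?thesis using \<open>y \<in> C\<close>
    proof induction
      case (base y)
      then show ?case using \<open>x \<in> C\<close> by auto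
    next
      case (step z y)
      have "(i, z) \<in> E\<^sup>+" using \<open>x \<in> C\<close> step.hyps(1) by (auto simp: C_def)
      moreover have "(z, i) \<in> E\<^sup>+"
        using step.hyps(2) step.prems by (auto simp: C_def intro: trancl_into_trancl2)
      ultimately have "z \<in> C" by (simp add: C_def)
      then show ?case using step.IH step.hyps(2) step.prems by (auto intro: trancl_into_trancl)
    qed
  qed
  moreover have "C \<noteq> {}" using i by (auto simp: C_def)
  ultimately show thesis by (intro that[of C])
qed

text \<open>A strongly connected set of pairs takes the place of a single alternating cycle, so that
  invariants can be carried from any pair to any other.\<close>

definition alternating_component :: "'a rel \<Rightarrow> 'a rel \<Rightarrow> bool" where
  "alternating_component R C \<longleftrightarrow> C \<noteq> {} \<and> (\<forall>x\<in>C. \<forall>y\<in>C. (x, y) \<in> (alternation R C)\<^sup>+)"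

lemma ex_alternating_component:
  assumes "\<not> acyclic (alternation R I)"
  obtains C where "C \<subseteq> I" and "alternating_component R C"
proof -
  let ?E = "alternation R I"
  obtain C where C: "C \<noteq> {}" "\<And>x y. x \<in> C \<Longrightarrow> y \<in> C \<Longrightarrow> (x, y) \<in> (?E \<inter> C \<times> C)\<^sup>+"
    using not_acyclic_imp_strongly_connected[OF assms] by blast
  have "x \<in> I" if "x \<in> C" for x
    using C(2)[OF that that] by (auto simp: alternation_def elim: tranclE)
  then have "C \<subseteq> I" by blast
  moreover from this have "?E \<inter> C \<times> C = alternation R C" by (auto simp: alternation_def)
  with C have "alternating_component R C" unfolding alternating_component_def by metis
  ultimately show thesis by (rule that)
qed

lemma alternating_component_propagate:
  assumes "alternating_component R C"
    and step: "\<And>a b a' b'. (a, b) \<in> C \<Longrightarrow> (a', b') \<in> C \<Longrightarrow> (a, b') \<in> R \<Longrightarrow> P a b \<Longrightarrow> P a' b'"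
    and ab: "(a, b) \<in> C" "P a b" "(a', b') \<in> C"
  shows "P a' b'"
proof -
  have "case_prod P y" if "((a, b), y) \<in> (alternation R C)\<^sup>+" for y
    using that
  proof induction
    case (base y)
    then show ?case using step ab(1,2) by (auto simp: alternation_def)
  next
    case (step y z)
    then show ?case using assms(2) by (cases y; cases z) (auto simp: alternation_def)
  qed
  then show ?thesis using assms(1) ab(1,3) unfolding alternating_component_def by fastforce
qed

lemma alternating_component_succ_pred:
  assumes "alternating_component R C" "(a, b) \<in> C"
  shows "\<exists>a' b'. (a', b') \<in> C \<and> (a, b') \<in> R" and "\<exists>a' b'. (a', b') \<in> C \<and> (a', b) \<in> R"
proof -
  have *: "((a, b), (a, b)) \<in> (alternation R C)\<^sup>+"
    using assms by (auto simp: alternating_component_def)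
  from tranclD[OF *] show "\<exists>a' b'. (a', b') \<in> C \<and> (a, b') \<in> R" by (auto simp: alternation_def)
  from tranclD2[OF *] show "\<exists>a' b'. (a', b') \<in> C \<and> (a', b) \<in> R" by (auto simp: alternation_def)
qed


section \<open>Separations of the poset along the elimination tree\<close>

text \<open>Induction on the size of the interval from \<open>x\<close> to \<open>y\<close>: unless
  it is a cover, a point strictly between splits it, and \<open>P\<close> changes on one of the two
  parts. This finds a cover edge on the boundary of a set of vertices.\<close>

lemma cover_crossing:
  assumes fin: "finite X" and po: "partial_order_on X R"
    and "(x, y) \<in> R" "P x" "\<not> P y"
  shows "\<exists>x' y'. covered_by X R x' y' \<and> (x, x') \<in> R \<and> (y', y) \<in> R \<and> P x' \<and> \<not> P y'"
  using assms(3-5)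
proof (induction "card {z \<in> X. (x, z) \<in> R \<and> (z, y) \<in> R}" arbitrary: x y rule: less_induct)
  case less
  have R: "refl_on X R" "trans R" "antisym R" "R \<subseteq> X \<times> X"
    using po by (auto simp: partial_order_on_def preorder_on_def)
  have xy: "x \<in> X" "y \<in> X" "x \<noteq> y" using less.prems R(4) by auto
  then have refl: "(x, x) \<in> R" "(y, y) \<in> R" using R(1) by (auto dest: refl_onD)
  show ?case
  proof (cases "covered_by X R x y")
    case True
    then show ?thesis using less.prems refl by blast
  next
    case False
    then obtain z where z: "z \<in> X" "(x, z) \<in> R" "(z, y) \<in> R" "z \<noteq> x" "z \<noteq> y"
      using xy less.prems by (auto simp: covered_by_def strictly_below_def)
    have yz: "(y, z) \<notin> R" "(z, x) \<notin> R" using z R(3) by (auto dest: antisymD)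
    show ?thesis
    proof (cases "P z")
      case True
      have "{w \<in> X. (z, w) \<in> R \<and> (w, y) \<in> R} \<subset> {w \<in> X. (x, w) \<in> R \<and> (w, y) \<in> R}"
        using z yz xy refl R(2) less.prems(1) by (blast dest: transD)
      then have "card {w \<in> X. (z, w) \<in> R \<and> (w, y) \<in> R} < card {w \<in> X. (x, w) \<in> R \<and> (w, y) \<in> R}"
        using fin by (intro psubset_card_mono) auto
      from less.hyps[OF this z(3) True less.prems(3)] show ?thesis
        using z(2) R(2) by (meson transD)
    next
      case False
      have "{w \<in> X. (x, w) \<in> R \<and> (w, z) \<in> R} \<subset> {w \<in> X. (x, w) \<in> R \<and> (w, y) \<in> R}"
        using z yz xy refl R(2) less.prems(1) by (blast dest: transD)
      then have "card {w \<in> X. (x, w) \<in> R \<and> (w, z) \<in> R} < card {w \<in> X. (x, w) \<in> R \<and> (w, y) \<in> R}"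
        using fin by (intro psubset_card_mono) auto
      from less.hyps[OF this z(2) less.prems(2) False] show ?thesis
        using z(3) R(2) by (meson transD)
    qed
  qed
qed

text \<open>
  The root \<open>a0\<close> doubles as a dummy gate for vertices that have fewer than two earlier neighbours.
\<close>
locale gated_poset =
  fixes X :: "'a set" and R :: "'a rel" and a0 :: 'a
    and l r p :: "'a \<Rightarrow> 'a" and idx :: "'a \<Rightarrow> nat"
  assumes fin: "finite X" and po: "partial_order_on X R" and a0: "a0 \<in> X"
    and inj: "inj_on idx X"
    and root: "l a0 = a0" "r a0 = a0"
    and parent: "v \<in> X \<Longrightarrow> v \<noteq> a0 \<Longrightarrow> p v \<in> X \<and> idx (p v) < idx v"
    and gates: "v \<in> X \<Longrightarrow> v \<noteq> a0 \<Longrightarrow> l v = l (p v) \<and> r v = p v \<or> l v = p v \<and> r v = r (p v)"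
    and cover: "covered_by X R x y \<Longrightarrow> x \<in> {l y, r y} \<or> y \<in> {l x, r x}"
begin

lemma transR: "(x, y) \<in> R \<Longrightarrow> (y, z) \<in> R \<Longrightarrow> (x, z) \<in> R"
  using po by (auto simp: partial_order_on_def preorder_on_def dest: transD)

lemma reflR: "x \<in> X \<Longrightarrow> (x, x) \<in> R"
  using po by (auto simp: partial_order_on_def preorder_on_def dest: refl_onD)

section \<open>Descendants in the elimination tree\<close>

definition parent_rel :: "'a rel" where
  "parent_rel = {(c, p c) | c. c \<in> X \<and> c \<noteq> a0}"

definition desc :: "'a \<Rightarrow> 'a set" where
  "desc v = {x \<in> X. (x, v) \<in> parent_rel\<^sup>*}"

definition children :: "'a \<Rightarrow> 'a set" where
  "children v = {c \<in> X. c \<noteq> a0 \<and> p c = v}"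

lemma desc_self: "v \<in> X \<Longrightarrow> v \<in> desc v"
  by (simp add: desc_def)

lemma desc_subset: "x \<in> desc v \<Longrightarrow> x \<in> X"
  by (simp add: desc_def)

lemma desc_trans: "x \<in> desc u \<Longrightarrow> u \<in> desc v \<Longrightarrow> x \<in> desc v"
  by (auto simp: desc_def)

lemma desc_idx: "x \<in> desc v \<Longrightarrow> x = v \<or> idx v < idx x"
proof -
  have "(x, v) \<in> parent_rel\<^sup>* \<Longrightarrow> x = v \<or> idx v < idx x"
    by (induction rule: converse_rtrancl_induct) (use parent in \<open>force simp: parent_rel_def\<close>)+
  then show "x \<in> desc v \<Longrightarrow> x = v \<or> idx v < idx x" by (simp add: desc_def)
qed

lemma desc_base: "x \<in> desc v \<Longrightarrow> v \<in> X"
proof -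
  have "(x, v) \<in> parent_rel\<^sup>* \<Longrightarrow> x \<in> X \<Longrightarrow> v \<in> X"
    by (induction rule: rtrancl_induct) (use parent in \<open>auto simp: parent_rel_def\<close>)
  then show "x \<in> desc v \<Longrightarrow> v \<in> X" by (simp add: desc_def)
qed

lemma children_desc: "c \<in> children v \<Longrightarrow> c \<in> desc v"
  by (auto simp: children_def desc_def parent_rel_def)

lemma children_idx: "c \<in> children v \<Longrightarrow> idx v < idx c"
  using parent by (auto simp: children_def)

lemma not_in_desc_child: "c \<in> children v \<Longrightarrow> v \<notin> desc c"
  using children_idx desc_idx by fastforce

lemma desc_child_subset: "c \<in> children v \<Longrightarrow> x \<in> desc c \<Longrightarrow> x \<in> desc v"
  using children_desc desc_trans by blast

lemma desc_childE:
  assumes "x \<in> desc v" and "x \<noteq> v"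
  obtains c where "c \<in> children v" and "x \<in> desc c"
proof -
  from assms obtain c where "(x, c) \<in> parent_rel\<^sup>*" "(c, v) \<in> parent_rel"
    by (auto simp: desc_def elim: rtranclE)
  with assms(1) show thesis using that[of c] by (auto simp: desc_def children_def parent_rel_def)
qed

lemma desc_parent: "x \<in> desc v \<Longrightarrow> x \<noteq> v \<Longrightarrow> p x \<in> desc v"
  by (auto simp: desc_def parent_rel_def parent elim: converse_rtranclE)

text \<open>Each vertex has at most one parent, so its ancestors form a chain.\<close>

lemma desc_comparable:
  assumes "x \<in> desc u" and "x \<in> desc v"
  shows "u \<in> desc v \<or> v \<in> desc u"
proof -
  have "single_valued parent_rel" by (auto simp: single_valued_def parent_rel_def)
  moreover have "(x, u) \<in> parent_rel\<^sup>*" "(x, v) \<in> parent_rel\<^sup>*"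
    using assms by (simp_all add: desc_def)
  ultimately have "(u, v) \<in> parent_rel\<^sup>* \<or> (v, u) \<in> parent_rel\<^sup>*"
    by (rule single_valued_confluent)
  then show ?thesis using desc_base[OF assms(1)] desc_base[OF assms(2)] by (simp add: desc_def)
qed

lemma children_disjoint:
  assumes "c \<in> children v" "c' \<in> children v" "x \<in> desc c" "x \<in> desc c'"
  shows "c = c'"
proof -
  have "c = c'" if "c \<in> desc c'" "c \<in> children v" "c' \<in> children v" for c c'
    using desc_parent[OF that(1)] that not_in_desc_child[OF that(3)] by (auto simp: children_def)
  then show ?thesis using desc_comparable[OF assms(3,4)] assms(1,2) by blast
qed

lemma desc_root: "x \<in> X \<Longrightarrow> x \<in> desc a0"
proof (induction "idx x" arbitrary: x rule: less_induct)
  case less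
  show ?case
  proof (cases "x = a0")
    case False
    then have "p x \<in> desc a0" using less parent by blast
    moreover have "x \<in> desc (p x)" using less.prems False by (auto simp: desc_def parent_rel_def)
    ultimately show ?thesis by (rule desc_trans[rotated])
  qed (use less.prems desc_self in simp)
qed

section \<open>Gates separate the descendants of a vertex\<close>

text \<open>Each gate of \<open>v\<close> is its parent or a gate of its parent, so induction climbs
  to the root, whose gates are the root itself.\<close>

lemma gate_desc:
  assumes "v \<in> X" "g \<in> {l v, r v}"
  shows "v \<in> desc g \<and> (v \<noteq> a0 \<longrightarrow> idx g < idx v)"
  using assms
proof (induction "idx v" arbitrary: v g rule: less_induct)
  case less
  show ?case
  proof (cases "v = a0")
    case True
    then show ?thesis using less.prems root desc_self by auto
  next
    case False
    have pv: "p v \<in> X" "idx (p v) < idx v" using parent less.prems False by auto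
    have v: "v \<in> desc (p v)" using less.prems False by (auto simp: desc_def parent_rel_def)
    have "g = p v \<or> g \<in> {l (p v), r (p v)}" using gates less.prems False by auto
    then show ?thesis
    proof
      assume g: "g \<in> {l (p v), r (p v)}"
      from less.hyps[OF pv(2,1) g] show ?thesis using pv(2) v root g
        by (cases "p v = a0") (auto intro: desc_trans)
    qed (use v pv in auto)
  qed
qed

lemma gate_notin: "v \<in> X \<Longrightarrow> v \<noteq> a0 \<Longrightarrow> g \<in> {l v, r v} \<Longrightarrow> g \<notin> desc v"
  using gate_desc desc_idx by fastforce

text \<open>On the way down from \<open>v\<close>, each gate is the parent, which descends from
  \<open>v\<close>, or is inherited.\<close>

lemma gates_within:
  assumes "x \<in> desc v"
  shows "{l x, r x} \<subseteq> desc v \<union> {l v, r v}"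
proof -
  have "(x, v) \<in> parent_rel\<^sup>*" using assms by (simp add: desc_def)
  then show ?thesis
  proof (induction rule: converse_rtrancl_induct)
    case (step x y)
    then have "y = p x" "x \<in> X" "x \<noteq> a0" by (auto simp: parent_rel_def)
    moreover have "y \<in> desc v" using step.hyps calculation parent by (auto simp: desc_def)
    ultimately show ?case using gates[of x] step.IH by auto
  qed simp
qed

text \<open>If \<open>x\<close> were a gate of \<open>y\<close>, then \<open>y\<close> would descend
  from \<open>x\<close> and thus from \<open>v\<close>. So \<open>y\<close> is a gate of
  \<open>x\<close>, and outside \<open>desc v\<close> only gates of \<open>v\<close> are
  left.\<close>

lemma cover_gate:
  assumes "x \<in> desc v" "y \<notin> desc v" "y \<in> X" "x \<in> {l y, r y} \<or> y \<in> {l x, r x}"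
  shows "y \<in> {l v, r v}"
  using assms gate_desc[of y x] gates_within[of x v] desc_trans by blast

text \<open>Somewhere on the way from \<open>x\<close> to \<open>y\<close> a cover edge leaves
  \<open>desc v\<close>, and its outer end is a gate of \<open>v\<close>.\<close>

lemma gate_out:
  assumes "x \<in> desc v" "y \<notin> desc v" "(x, y) \<in> R"
  shows "\<exists>g\<in>{l v, r v}. (x, g) \<in> R \<and> (g, y) \<in> R"
proof -
  obtain x' y' where xy: "covered_by X R x' y'" "(x, x') \<in> R" "(y', y) \<in> R" "x' \<in> desc v" "y' \<notin> desc v"
    using cover_crossing[OF fin po assms(3), of "\<lambda>z. z \<in> desc v"] assms(1,2) by blast
  have "y' \<in> X" "(x', y') \<in> R" using xy(1) by (auto simp: covered_by_def strictly_below_def)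
  then show ?thesis using cover_gate[OF xy(4,5)] cover[OF xy(1)] xy(2,3) transR by blast
qed

lemma gate_in:
  assumes "x \<notin> desc v" "y \<in> desc v" "(x, y) \<in> R"
  shows "\<exists>g\<in>{l v, r v}. (x, g) \<in> R \<and> (g, y) \<in> R"
proof -
  obtain x' y' where xy: "covered_by X R x' y'" "(x, x') \<in> R" "(y', y) \<in> R" "x' \<notin> desc v" "y' \<in> desc v"
    using cover_crossing[OF fin po assms(3), of "\<lambda>z. z \<notin> desc v"] assms(1,2) by blast
  have "x' \<in> X" "(x', y') \<in> R" using xy(1) by (auto simp: covered_by_def strictly_below_def)
  then show ?thesis using cover_gate[OF xy(5,4)] cover[OF xy(1)] xy(2,3) transR by blast
qed

text \<open>Paths from \<open>l v\<close> to \<open>r u\<close> and from \<open>r v\<close> to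
  \<open>l u\<close> have to meet, and switching paths there leads from \<open>l v\<close> to
  \<open>l u\<close>. Formally, on the way down from \<open>v\<close> one gate is inherited and the
  other becomes the parent \<open>w\<close>; a path to \<open>w\<close> passes a gate of
  \<open>w\<close>, where the induction hypothesis applies or the claim is immediate.\<close>

lemma gates_not_swapped:
  assumes "u \<in> desc v" "v \<noteq> a0" "(l v, r u) \<in> R" "(r v, l u) \<in> R"
  shows "(l v, l u) \<in> R"
proof -
  have v: "v \<in> X" using assms(1) desc_base by blast
  have "(u, v) \<in> parent_rel\<^sup>*" using assms(1) by (simp add: desc_def)
  then show ?thesis using assms(3,4)
  proof (induction rule: converse_rtrancl_induct)
    case base
    then show ?case using transR by blast
  next
    case (step u w)
    then have u: "w = p u" "u \<in> X" "u \<noteq> a0" by (auto simp: parent_rel_def)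
    then have w: "w \<in> desc v" using step.hyps parent by (auto simp: desc_def)
    have enter: "(g, l w) \<in> R \<and> (l w, w) \<in> R \<or> (g, r w) \<in> R \<and> (r w, w) \<in> R"
      if "g \<in> {l v, r v}" "(g, w) \<in> R" for g
    proof -
      have "g \<notin> desc w" using gate_notin[OF v assms(2) that(1)] desc_trans w by blast
      then show ?thesis using gate_in[OF _ _ that(2)] desc_self desc_subset[OF w] by blast
    qed
    from gates[OF u(2,3)] show ?case
    proof
      assume g: "l u = l (p u) \<and> r u = p u"
      then show ?thesis using enter[of "l v"] step.prems step.IH u(1) by auto
    next
      assume g: "l u = p u \<and> r u = r (p u)"
      then show ?thesis using enter[of "r v"] step.prems step.IH u(1) transR by auto
    qed
  qed
qed

section \<open>Branching order and exit vertices\<close>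

text \<open>Compares the two children of the lowest common ancestor below which \<open>a\<close> and
  \<open>b\<close> lie. It is false if one of \<open>a\<close> and \<open>b\<close> is an ancestor
  of the other.\<close>

definition before :: "'a \<Rightarrow> 'a \<Rightarrow> bool" where
  "before a b \<longleftrightarrow> (\<exists>v. \<exists>c\<in>children v. \<exists>c'\<in>children v. a \<in> desc c \<and> b \<in> desc c' \<and> idx c < idx c')"

text \<open>The branching vertex and its children are unique: if \<open>c\<close> were a proper
  descendant of \<open>d\<close>, then the parent of \<open>c\<close>, and with it \<open>b\<close>,
  would lie below \<open>d\<close>, although \<open>b\<close> lies below a sibling of
  \<open>d\<close>.\<close>

lemma before_iff:
  assumes "c \<in> children v" "c' \<in> children v" "a \<in> desc c" "b \<in> desc c'" "c \<noteq> c'"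
  shows "before a b \<longleftrightarrow> idx c < idx c'"
proof
  assume "before a b"
  then obtain w d d' where w: "d \<in> children w" "d' \<in> children w" "a \<in> desc d" "b \<in> desc d'" "idx d < idx d'"
    by (auto simp: before_def)
  have up: "c = d" if c: "c \<in> desc d" "c \<in> children v" "c' \<in> children v" "b \<in> desc c'"
    and d: "d \<in> children w" "d' \<in> children w" "b \<in> desc d'" "d \<noteq> d'" for c c' v d d' w
  proof (rule ccontr)
    assume "c \<noteq> d"
    then have "v \<in> desc d" using desc_parent[OF c(1)] c(2) by (simp add: children_def)
    then have "b \<in> desc d" using c(3,4) desc_child_subset desc_trans by blast
    then show False using children_disjoint[OF d(1,2)] d(3,4) by blast
  qed
  have "c = d"
    using desc_comparable[OF assms(3) w(3)]
  proof
    assume "c \<in> desc d"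
    from up[OF this assms(1,2,4) w(1,2,4)] w(5) show ?thesis by auto
  next
    assume "d \<in> desc c"
    from up[OF this w(1,2,4) assms(1,2,4,5)] show ?thesis by simp
  qed
  moreover from this have "v = w" using assms(1) w(1) by (simp add: children_def)
  ultimately show "idx c < idx c'" using children_disjoint[OF assms(2) _ assms(4)] w by blast
qed (use assms in \<open>auto simp: before_def\<close>)

definition exit :: "'a \<Rightarrow> 'a \<Rightarrow> bool" where
  "exit a u \<longleftrightarrow> u \<noteq> a0 \<and> a \<in> desc u \<and> (\<forall>g\<in>{l u, r u}. (a, g) \<notin> R) \<and>
     (\<forall>v\<in>desc u. a \<in> desc v \<and> v \<noteq> u \<longrightarrow> (\<exists>g\<in>{l v, r v}. (a, g) \<in> R))"

text \<open>The child of \<open>a0\<close> from which \<open>a\<close> descends has both gates equal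
  to \<open>a0\<close>, so \<open>a\<close> is below neither. Among all ancestors of
  \<open>a\<close> with this property the one of largest index is the lowest.\<close>

lemma ex_exit:
  assumes "a \<in> X" "(a, a0) \<notin> R"
  shows "\<exists>u. exit a u"
proof -
  let ?A = "{v. v \<noteq> a0 \<and> a \<in> desc v \<and> (\<forall>g\<in>{l v, r v}. (a, g) \<notin> R)}"
  have "a \<noteq> a0" using assms reflR by auto
  then obtain c where c: "c \<in> children a0" "a \<in> desc c" using desc_childE desc_root[OF assms(1)] by blast
  then have "c \<in> ?A" using gates[of c] root assms(2) by (auto simp: children_def)
  then have ne: "?A \<noteq> {}" by blast
  have "?A \<subseteq> X" using desc_base by blast
  then have "finite ?A" using fin finite_subset by blast
  from ex_maximal_value[OF this ne, of idx]
  obtain u where u: "u \<in> ?A" "\<And>v. v \<in> ?A \<Longrightarrow> idx v \<le> idx u" by blast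
  have "\<exists>g\<in>{l v, r v}. (a, g) \<in> R" if v: "v \<in> desc u" "a \<in> desc v" "v \<noteq> u" for v
  proof (rule ccontr)
    assume neg: "\<not> ?thesis"
    have "idx u < idx v" using desc_idx v by blast
    then have "v \<noteq> a0" using u(1) desc_idx[of u a0] desc_root desc_base[OF v(1)] by auto
    then have "v \<in> ?A" using neg v by blast
    with u(2)[of v] \<open>idx u < idx v\<close> show False by simp
  qed
  then show ?thesis using u(1) by (auto simp: exit_def)
qed

text \<open>The child of \<open>u\<close> on the way to \<open>a\<close> has its gates among
  \<open>l u\<close>, \<open>u\<close> and \<open>r u\<close>. By the choice of \<open>u\<close>,
  one of its gates is above \<open>a\<close>, and this can only be \<open>u\<close>.\<close>

lemma exit_above:
  assumes "exit a u"
  shows "(a, u) \<in> R"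
proof (cases "a = u")
  case False
  have a: "a \<in> desc u" using assms by (simp add: exit_def)
  then obtain c where c: "c \<in> children u" "a \<in> desc c" using False desc_childE by blast
  have "c \<in> desc u" "c \<noteq> u" using children_desc[OF c(1)] children_idx[OF c(1)] by auto
  with assms c(2) have "\<exists>g\<in>{l c, r c}. (a, g) \<in> R" by (auto simp: exit_def)
  moreover have "{l c, r c} \<subseteq> {l u, u, r u}" using gates[of c] c(1) by (auto simp: children_def)
  ultimately show ?thesis using assms by (auto simp: exit_def)
qed (use assms desc_subset reflR in \<open>auto simp: exit_def\<close>)

lemma exit_confined: "exit a u \<Longrightarrow> (a, y) \<in> R \<Longrightarrow> y \<in> desc u"
  unfolding exit_def using gate_out by blast

end

section \<open>The two sides of a vertex\<close>

context gated_poset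
begin

text \<open>A child with left gate \<open>v\<close> was inserted between \<open>v\<close> and
  \<open>r v\<close>, and its whole subtree counts as right of \<open>v\<close>. At the root all
  gates coincide and each side contains all proper descendants, so disjointness is claimed for
  \<open>v \<noteq> a0\<close>.\<close>

definition right_of :: "'a \<Rightarrow> 'a set" where
  "right_of v = (\<Union>c\<in>{c \<in> children v. l c = v \<and> r c = r v}. desc c)"

definition left_of :: "'a \<Rightarrow> 'a set" where
  "left_of v = (\<Union>c\<in>{c \<in> children v. l c = l v \<and> r c = v}. desc c)"

lemma right_of_desc: "x \<in> right_of v \<Longrightarrow> x \<in> desc v"
  using desc_child_subset by (auto simp: right_of_def)

lemma desc_cases:
  assumes "x \<in> desc v" and "v \<noteq> a0"
  shows "x = v \<or> x \<in> left_of v \<or> x \<in> right_of v"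
proof (cases "x = v")
  case False
  with assms(1) obtain c where "c \<in> children v" "x \<in> desc c" by (rule desc_childE)
  then show ?thesis using gates[of c] by (auto simp: left_of_def right_of_def children_def)
qed simp

text \<open>A common child would force \<open>l v = v\<close>, but the gates of
  \<open>v \<noteq> a0\<close> have smaller index.\<close>

lemma left_right_disjoint:
  assumes "x \<in> left_of v" and "v \<noteq> a0"
  shows "x \<notin> right_of v"
proof
  assume "x \<in> right_of v"
  with assms obtain c where c: "c \<in> children v" "l c = l v" "l c = v" "x \<in> desc c"
    unfolding left_of_def right_of_def using children_disjoint by blast
  have "v \<in> X" using desc_base children_desc[OF c(1)] by blast
  then show False using gate_desc[of v "l v"] assms(2) c by auto
qed

end


section \<open>Cycles of pairs\<close>

text \<open>Treats the class in which each \<open>b\<close> lies right of the exit vertex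
  \<open>e a\<close>. The left class follows by exchanging \<open>l\<close> and
  \<open>r\<close>.\<close>

locale right_cycle = gated_poset +
  fixes C :: "('a \<times> 'a) set" and e :: "'a \<Rightarrow> 'a"
  assumes component: "alternating_component R C"
    and incomparable: "(a, b) \<in> C \<Longrightarrow> (a, b) \<notin> R"
    and a0_below: "(a, b) \<in> C \<Longrightarrow> (a0, b) \<in> R"
    and exit: "(a, b) \<in> C \<Longrightarrow> exit a (e a)"
    and right: "(a, b) \<in> C \<Longrightarrow> b \<in> right_of (e a)"
begin

lemmas propagate = alternating_component_propagate[OF component]

lemma exit_idx: "(a, b) \<in> C \<Longrightarrow> a \<in> desc (e a) \<and> e a \<noteq> a0 \<and> e a \<in> X"
  using exit[of a b] desc_base by (auto simp: exit_def)

lemma confined: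
  assumes "(a, b) \<in> C" "(a, y) \<in> R"
  shows "y \<in> desc (e a)"
  using exit_confined exit assms by blast

lemma rightE:
  assumes "(a, b) \<in> C"
  obtains c where "c \<in> children (e a)" "l c = e a" "r c = r (e a)" "b \<in> desc c"
  using right[OF assms] by (auto simp: right_of_def)

lemma exit_not_below: "(a, b) \<in> C \<Longrightarrow> (e a, b) \<notin> R"
  using exit_above[of a "e a"] exit[of a b] incomparable transR by blast

text \<open>\<open>b\<close> lies below a child with gates \<open>e a\<close> and
  \<open>r (e a)\<close>, so a path from outside uses one of them. It is not \<open>e a\<close>,
  because \<open>a\<close> lies below \<open>e a\<close> but not below \<open>b\<close>.\<close>

lemma enter_right:
  assumes ab: "(a, b) \<in> C" and g: "(g, b) \<in> R" "g \<notin> right_of (e a)"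
  shows "(g, r (e a)) \<in> R \<and> (r (e a), b) \<in> R"
proof -
  obtain c where c: "c \<in> children (e a)" "l c = e a" "r c = r (e a)" "b \<in> desc c"
    using ab by (rule rightE)
  have "g \<notin> desc c" using g(2) c by (auto simp: right_of_def)
  then show ?thesis using gate_in[OF _ c(4) g(1)] c exit_not_below[OF ab] by auto
qed

lemma a0_notin_desc: "v \<in> X \<Longrightarrow> v \<noteq> a0 \<Longrightarrow> a0 \<notin> desc v"
  using desc_idx desc_root by (metis less_asym')

lemma right_gate_below:
  assumes "(a, b) \<in> C"
  shows "(r (e a), b) \<in> R"
proof -
  have "a0 \<notin> right_of (e a)"
    using a0_notin_desc desc_subset by (auto simp: right_of_def children_def)
  then show ?thesis using enter_right[OF assms a0_below[OF assms]] by simp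
qed

lemma a0_enters:
  assumes "(a, b) \<in> C" "v \<noteq> a0" "b \<in> desc v"
  shows "(l v, b) \<in> R \<or> (r v, b) \<in> R"
  using gate_in[OF a0_notin_desc assms(3) a0_below[OF assms(1)]] assms(2) desc_base[OF assms(3)] by auto

lemma exit_reaches:
  assumes "(a, b) \<in> C" "v \<in> desc (e a)" "v \<noteq> e a" "a \<in> desc v"
  shows "(a, l v) \<in> R \<or> (a, r v) \<in> R"
  using exit[OF assms(1)] assms by (auto simp: exit_def)

text \<open>Induction downwards from \<open>e a\<close>, whose child containing \<open>b\<close> has
  gates \<open>e a\<close> and \<open>r (e a)\<close>. At each further step one gate is inherited.
  Since \<open>a\<close> lies below some gate, some gate lies below \<open>b\<close>, and these
  differ because \<open>a\<close> is not below \<open>b\<close>, the other gate is settled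
  too.\<close>

lemma passing:
  assumes ab: "(a, b) \<in> C" and v: "v \<in> desc (e a)" "v \<noteq> e a" "a \<in> desc v" "b \<in> desc v"
  shows "(a, l v) \<in> R \<and> (r v, b) \<in> R"
proof -
  have "(v, e a) \<in> parent_rel\<^sup>*" using v(1) by (simp add: desc_def)
  then show ?thesis using v(2-4)
  proof (induction rule: converse_rtrancl_induct)
    case (step v w)
    then have v: "w = p v" "v \<in> X" "v \<noteq> a0" by (auto simp: parent_rel_def)
    have ve: "v \<in> desc (e a)" using step.hyps v(2) by (auto simp: desc_def)
    show ?case
    proof (cases "w = e a")
      case True
      then have ch: "v \<in> children (e a)" using v by (simp add: children_def)
      obtain c where c: "c \<in> children (e a)" "l c = e a" "r c = r (e a)" "b \<in> desc c"
        using ab by (rule rightE)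
      have "v = c" using children_disjoint[OF ch c(1) step.prems(3) c(4)] .
      then show ?thesis using c exit_above[OF exit[OF ab]] right_gate_below[OF ab] by simp
    next
      case False
      have "v \<in> desc w" using v by (auto simp: desc_def parent_rel_def)
      then have "a \<in> desc w" "b \<in> desc w" using step.prems desc_trans by blast+
      with False step.IH have IH: "(a, l w) \<in> R" "(r w, b) \<in> R" by auto
      have "(a, l v) \<in> R \<or> (a, r v) \<in> R" using exit_reaches[OF ab ve] step.prems by auto
      moreover have "(l v, b) \<in> R \<or> (r v, b) \<in> R" using a0_enters[OF ab v(3)] step.prems by auto
      moreover have "\<not> ((a, g) \<in> R \<and> (g, b) \<in> R)" for g using incomparable[OF ab] transR by blast
      ultimately show ?thesis using gates[OF v(2,3)] IH v(1) by metis
    qed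
  qed simp
qed

text \<open>The two paths into \<open>desc c\<close> would otherwise have to cross.\<close>
lemma left_gate_step:
  assumes c: "c \<in> X" "c \<noteq> a0" and ab: "(a, b) \<in> C" "e a \<in> desc c" "(l c, b) \<in> R"
    and ab': "(a', b') \<in> C" "(a, b') \<in> R"
  shows "(l c, b') \<in> R"
proof -
  have sub: "desc (e a) \<subseteq> desc c" using ab(2) desc_trans by blast
  have b': "b' \<in> desc (e a)" using confined[OF ab(1) ab'(2)] .
  have notin: "l c \<notin> desc (e a)" "r c \<notin> desc (e a)" using gate_notin[OF c] sub by auto
  then have "l c \<notin> right_of (e a)"
    using desc_child_subset by (auto simp: right_of_def)
  then have lr: "(l c, r (e a)) \<in> R" using enter_right[OF ab(1,3)] by simp
  show ?thesis
  proof (cases "(r c, b') \<in> R")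
    case True
    from gate_in[OF notin(2) b' True]
    consider "(r c, l (e a)) \<in> R" "(l (e a), b') \<in> R" | "(r (e a), b') \<in> R" by auto
    then show ?thesis
    proof cases
      \<comment> \<open>The paths from \<open>l c\<close> to \<open>r (e a)\<close> and from
        \<open>r c\<close> to \<open>l (e a)\<close> cross, so \<open>gates_not_swapped\<close>
        leads from \<open>l c\<close> to \<open>l (e a)\<close> and on to \<open>b'\<close>.\<close>
      case 1
      then show ?thesis using gates_not_swapped[OF ab(2) c(2) lr] transR by blast
    next
      case 2
      then show ?thesis using lr transR by blast
    qed
  next
    case False
    then show ?thesis using a0_enters[OF ab'(1) c(2)] b' sub by auto
  qed
qed

text \<open>A path from \<open>a\<close> to \<open>b'\<close> that does not stay below one child
  passes \<open>v\<close>, \<open>l v\<close> or \<open>r v\<close>. The gates are excluded first;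
  for \<open>v\<close> itself the invariant \<open>P\<close> is carried through the component to
  \<open>(a, b)\<close>, where it is contradictory. The pair \<open>(a\<^sub>k, b\<^sub>k)\<close>
  guarantees \<open>v \<noteq> a0\<close>.\<close>

lemma same_child_right:
  assumes v: "\<And>a b. (a, b) \<in> C \<Longrightarrow> a \<in> desc v \<and> b \<in> desc v"
    and k: "(a\<^sub>k, b\<^sub>k) \<in> C" "v \<in> desc (e a\<^sub>k)"
    and ab: "(a, b) \<in> C" "(a', b') \<in> C" "(a, b') \<in> R"
  shows "\<exists>c\<in>children v. a \<in> desc c \<and> b' \<in> desc c"
proof -
  have vX: "v \<in> X" using k(2) desc_subset by blast
  have va0: "v \<noteq> a0" using k a0_notin_desc exit_idx by blast
  have cases: "v \<in> desc (e a) \<and> v \<noteq> e a \<or> e a = v \<or> (\<exists>c\<in>children v. e a \<in> desc c)"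
    if "(a, b) \<in> C" for a b
  proof (cases "e a \<in> desc v \<and> e a \<noteq> v")
    case True
    then show ?thesis using desc_childE[of "e a" v] by blast
  next
    case False
    then show ?thesis using desc_comparable[of a v "e a"] v[OF that] exit_idx[OF that] by blast
  qed
  have apart: "\<not> ((a, g) \<in> R \<and> (g, b) \<in> R)" if "(a, b) \<in> C" for a b g
    using incomparable[OF that] transR by blast
  \<comment> \<open>Were \<open>l v\<close> below some \<open>b\<close>,
    \<open>left_gate_step\<close> would carry this through the component to
    \<open>(a\<^sub>q, b\<^sub>q)\<close>, and \<open>passing\<close> puts \<open>a\<^sub>q\<close>
    below \<open>l v\<close>.\<close>
  have no_left: "(l v, b) \<notin> R"
    if q: "(a\<^sub>q, b\<^sub>q) \<in> C" "v \<in> desc (e a\<^sub>q)" "v \<noteq> e a\<^sub>q" and ab: "(a, b) \<in> C" for a\<^sub>q b\<^sub>q a b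
  proof
    assume l: "(l v, b) \<in> R"
    have "(l v, b\<^sub>q) \<in> R"
    proof (rule propagate[where P = "\<lambda>a b. (l v, b) \<in> R", OF _ ab l q(1)])
      fix a b a' b' assume *: "(a, b) \<in> C" "(a', b') \<in> C" "(a, b') \<in> R" "(l v, b) \<in> R"
      have "\<not> (v \<in> desc (e a) \<and> v \<noteq> e a)"
        using passing[OF *(1)] v[OF *(1)] apart[OF *(1)] *(4) by blast
      then have "e a \<in> desc v"
        using cases[OF *(1)] desc_self[OF vX] desc_child_subset by auto
      then show "(l v, b') \<in> R" using left_gate_step[OF vX va0 *(1) _ *(4,2,3)] by blast
    qed
    then show False using passing[OF q] v[OF q(1)] apart[OF q(1)] by blast
  qed
  \<comment> \<open>A pair with exit vertex strictly above \<open>v\<close> in the tree cannot use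
    \<open>r v\<close>, which lies below its own \<open>b\<close>, nor \<open>l v\<close>, by
    \<open>no_left\<close>. For the other pairs the gates of \<open>v\<close> are outside
    \<open>desc (e a)\<close>.\<close>
  have through: "(\<exists>c\<in>children v. a \<in> desc c \<and> b' \<in> desc c) \<or> (a, v) \<in> R \<and> (v, b') \<in> R"
    if ab: "(a, b) \<in> C" "(a', b') \<in> C" "(a, b') \<in> R" for a b a' b'
  proof (cases "a = v")
    case True
    then show ?thesis using ab(3) reflR vX by simp
  next
    case False
    then obtain c where c: "c \<in> children v" "a \<in> desc c" using v[OF ab(1)] desc_childE by blast
    have no: "\<not> ((a, g) \<in> R \<and> (g, b') \<in> R)" if g: "g \<in> {l v, r v}" for g
    proof (cases "v \<in> desc (e a) \<and> v \<noteq> e a")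
      case True
      then have "(r v, b) \<in> R" using passing[OF ab(1)] v[OF ab(1)] by blast
      then show ?thesis using g no_left[OF ab(1) _ _ ab(2)] True apart[OF ab(1)] by auto
    next
      case False
      then have "e a \<in> desc v" using cases[OF ab(1)] desc_self[OF vX] desc_child_subset by auto
      then show ?thesis using gate_notin[OF vX va0 g] confined[OF ab(1)] desc_trans by blast
    qed
    show ?thesis
    proof (cases "b' \<in> desc c")
      case False
      from gate_out[OF c(2) this ab(3)] obtain g where g: "g \<in> {l c, r c}" "(a, g) \<in> R" "(g, b') \<in> R"
        by blast
      have "g \<in> {l v, r v} \<or> g = v" using gates[of c] g(1) c(1) by (auto simp: children_def)
      then show ?thesis using no g by auto
    qed (use c in blast)
  qed
  \<comment> \<open>The invariant of the component. It excludes an exit vertex at \<open>v\<close>,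
    and at a pair whose exit vertex is a proper ancestor of \<open>v\<close> it puts
    \<open>v\<close> below \<open>b\<close>.\<close>
  define P where "P a b \<longleftrightarrow> (v, b) \<in> R \<or> b \<in> left_of v" for a b :: 'a
  have P_passing: "(v, b) \<in> R" if ab: "(a, b) \<in> C" "v \<in> desc (e a)" "v \<noteq> e a" "P a b" for a b
  proof (rule ccontr)
    assume neg: "(v, b) \<notin> R"
    then obtain c where c: "c \<in> children v" "l c = l v" "r c = v" "b \<in> desc c"
      using ab(4) by (auto simp: P_def left_of_def)
    then have "(l v, b) \<in> R"
      using a0_enters[OF ab(1) _ c(4)] neg by (auto simp: children_def)
    then show False using no_left[OF ab(1-3,1)] by blast
  qed
  have P_exit: "\<not> P a b" if "(a, b) \<in> C" "e a = v" for a b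
    using exit_not_below[OF that(1)] right[OF that(1)] left_right_disjoint[OF _ va0] that(2)
    by (auto simp: P_def)
  have P_step: "P a' b'" if ab: "(a, b) \<in> C" "(a', b') \<in> C" "(a, b') \<in> R" "P a b" for a b a' b'
    using cases[OF ab(1)]
  proof (elim disjE conjE bexE)
    assume pass: "v \<in> desc (e a)" "v \<noteq> e a"
    then have "(v, b) \<in> R" using P_passing ab by blast
    then have av: "(a, v) \<notin> R" using apart[OF ab(1)] by blast
    then obtain c where c: "c \<in> children v" "a \<in> desc c" "b' \<in> desc c"
      using through[OF ab(1-3)] by blast
    have "c \<in> desc (e a)" using children_desc[OF c(1)] pass(1) desc_trans by blast
    moreover have "c \<noteq> e a" using pass not_in_desc_child[OF c(1)] by blast
    ultimately have "(a, l c) \<in> R \<or> (a, r c) \<in> R" using exit_reaches[OF ab(1)] c(2) by blast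
    moreover have "(a, r v) \<notin> R"
      using passing[OF ab(1) pass] v[OF ab(1)] apart[OF ab(1)] by blast
    \<comment> \<open>\<open>a\<close> lies below a gate of \<open>c\<close> but below neither
      \<open>v\<close> nor \<open>r v\<close>, so \<open>c\<close> is a left child.\<close>
    ultimately have "l c = l v \<and> r c = v"
      using gates[of c] c(1) av by (auto simp: children_def)
    then show ?thesis using c by (auto simp: P_def left_of_def)
  next
    assume "e a = v"
    then show ?thesis using P_exit ab by blast
  next
    fix c assume c: "c \<in> children v" "e a \<in> desc c"
    have cX: "c \<in> X" "c \<noteq> a0" using c(1) by (auto simp: children_def)
    have b': "b' \<in> desc c" using confined[OF ab(1,3)] c(2) desc_trans by blast
    have b: "b \<in> desc c"
      using desc_trans[OF right_of_desc[OF right[OF ab(1)]] c(2)] .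
    from gates[OF cX] show ?thesis
    proof
      assume "l c = l (p c) \<and> r c = p c"
      then show ?thesis using b' c(1) by (auto simp: P_def left_of_def children_def)
    next
      \<comment> \<open>Here \<open>v\<close> is the left gate of \<open>c\<close>, so
        \<open>P\<close> says that \<open>l c\<close> lies below \<open>b\<close>, which
        \<open>left_gate_step\<close> preserves.\<close>
      assume g: "l c = p c \<and> r c = r (p c)"
      then have "b \<in> right_of v" using b c(1) by (auto simp: right_of_def children_def)
      then have "b \<notin> left_of v" using left_right_disjoint[OF _ va0] by blast
      then have "(l c, b) \<in> R" using ab(4) g c(1) by (auto simp: P_def children_def)
      from left_gate_step[OF cX ab(1) c(2) this ab(2,3)] show ?thesis
        using g c(1) by (auto simp: P_def children_def)
    qed
  qed
  show ?thesis
  proof (rule ccontr)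
    assume "\<not> ?thesis"
    then have avb: "(a, v) \<in> R" "(v, b') \<in> R" using through[OF ab] by auto
    then have "P a' b'" by (simp add: P_def)
    from propagate[of P, OF P_step ab(2) this ab(1)] have Pab: "P a b" .
    from cases[OF ab(1)] show False
    proof (elim disjE conjE bexE)
      assume "v \<in> desc (e a)" "v \<noteq> e a"
      then show False using P_passing[OF ab(1) _ _ Pab] apart[OF ab(1)] avb by blast
    next
      assume "e a = v"
      then show False using P_exit[OF ab(1)] Pab by blast
    next
      fix c assume c: "c \<in> children v" "e a \<in> desc c"
      then have "v \<in> desc c" using confined[OF ab(1) avb(1)] desc_trans by blast
      then show False using not_in_desc_child[OF c(1)] by blast
    qed
  qed
qed

end

text \<open>The assumptions of the locale are symmetric in \<open>l\<close> and \<open>r\<close>;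
  this turns results about right sides into results about left sides.\<close>

lemma (in gated_poset) mirror: "gated_poset X R a0 r l p idx"
  using fin po a0 inj root parent gates cover by unfold_locales blast+

lemma (in gated_poset) mirror_exit: "gated_poset.exit X R a0 r l p a u \<longleftrightarrow> exit a u"
  unfolding gated_poset.exit_def[OF mirror] exit_def by (simp add: insert_commute)

lemma (in gated_poset) mirror_right_of: "gated_poset.right_of X a0 r l p v = left_of v"
  unfolding gated_poset.right_of_def[OF mirror] left_of_def by (simp add: conj_commute)

section \<open>Descent in the elimination tree and the six classes\<close>

context gated_poset
begin

text \<open>Along an arc from \<open>(a, b)\<close> to \<open>(a', b')\<close> the children
  containing \<open>a\<close> and \<open>b'\<close> agree, and from \<open>b'\<close> to
  \<open>a'\<close> the index of the child moves, if at all, in the one direction fixed by the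
  branching order. So it is monotone along arcs, hence constant on a strongly connected set.\<close>

lemma children_of_component:
  assumes C: "alternating_component R C"
    and order: "(\<forall>(a, b)\<in>C. before a b) \<or> (\<forall>(a, b)\<in>C. \<not> before a b)"
    and same: "\<And>a b a' b'. (a, b) \<in> C \<Longrightarrow> (a', b') \<in> C \<Longrightarrow> (a, b') \<in> R \<Longrightarrow>
      \<exists>c\<in>children v. a \<in> desc c \<and> b' \<in> desc c"
  shows "\<exists>c\<in>children v. \<forall>(a, b)\<in>C. a \<in> desc c \<and> b \<in> desc c"
proof -
  define ch where "ch x = (THE c. c \<in> children v \<and> x \<in> desc c)" for x
  have ch_eq: "ch x = c" if "c \<in> children v" "x \<in> desc c" for x c
    unfolding ch_def using that children_disjoint by (intro the_equality) blast+
  have a_ch: "ch a \<in> children v \<and> a \<in> desc (ch a)" if "(a, b) \<in> C" for a b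
    using alternating_component_succ_pred(1)[OF C that] same that ch_eq by metis
  have b_ch: "ch b \<in> children v \<and> b \<in> desc (ch b)" if "(a, b) \<in> C" for a b
    using alternating_component_succ_pred(2)[OF C that] same that ch_eq by metis
  have edge: "ch b' = ch a" if "(a, b) \<in> C" "(a', b') \<in> C" "(a, b') \<in> R" for a b a' b'
    using same[OF that] ch_eq by blast
  have idx_eq: "ch a = ch a'" if "idx (ch a) = idx (ch a')" "(a, b) \<in> C" "(a', b') \<in> C" for a b a' b'
    using that a_ch inj by (auto simp: children_def inj_on_def)
  have before: "before a b \<longleftrightarrow> idx (ch a) < idx (ch b)" if "(a, b) \<in> C" "ch a \<noteq> ch b" for a b
    using before_iff that a_ch[OF that(1)] b_ch[OF that(1)] by blast
  have const: "ch a = ch a'" if ab: "(a, b) \<in> C" "(a', b') \<in> C" for a b a' b'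
    using order
  proof
    assume 1: "\<forall>(a, b)\<in>C. before a b"
    have le: "idx (ch y) \<le> idx (ch x)" if "(x, x') \<in> C" "(y, y') \<in> C" for x x' y y'
    proof (rule alternating_component_propagate[OF C, where P = "\<lambda>z _. idx (ch z) \<le> idx (ch x)", OF _ that(1) _ that(2)])
      fix a b a' b' assume *: "(a, b) \<in> C" "(a', b') \<in> C" "(a, b') \<in> R" "idx (ch a) \<le> idx (ch x)"
      have "idx (ch a') \<le> idx (ch b')" using before[OF *(2)] 1 *(2) by fastforce
      then show "idx (ch a') \<le> idx (ch x)" using edge[OF *(1-3)] *(4) by simp
    qed simp
    then show ?thesis using le[OF ab] le[OF ab(2,1)] idx_eq[OF _ ab] by simp
  next
    assume 1: "\<forall>(a, b)\<in>C. \<not> before a b"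
    have le: "idx (ch x) \<le> idx (ch y)" if "(x, x') \<in> C" "(y, y') \<in> C" for x x' y y'
    proof (rule alternating_component_propagate[OF C, where P = "\<lambda>z _. idx (ch x) \<le> idx (ch z)", OF _ that(1) _ that(2)])
      fix a b a' b' assume *: "(a, b) \<in> C" "(a', b') \<in> C" "(a, b') \<in> R" "idx (ch x) \<le> idx (ch a)"
      have "idx (ch b') \<le> idx (ch a')" using before[OF *(2)] 1 *(2) by fastforce
      then show "idx (ch x) \<le> idx (ch a')" using edge[OF *(1-3)] *(4) by simp
    qed simp
    then show ?thesis using le[OF ab] le[OF ab(2,1)] idx_eq[OF _ ab] by simp
  qed
  obtain a b where ab: "(a, b) \<in> C" using C by (auto simp: alternating_component_def)
  have "a' \<in> desc (ch a) \<and> b' \<in> desc (ch a)" if ab': "(a', b') \<in> C" for a' b'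
  proof -
    obtain x y where xy: "(x, y) \<in> C" "(x, b') \<in> R"
      using alternating_component_succ_pred(2)[OF C ab'] by blast
    have "ch b' = ch a" using edge[OF xy(1) ab' xy(2)] const[OF xy(1) ab] by simp
    then show ?thesis using a_ch[OF ab'] b_ch[OF ab'] const[OF ab' ab] by simp
  qed
  then show ?thesis using a_ch[OF ab] by blast
qed

text \<open>Starting at the root, \<open>children_of_component\<close> forces all of
  \<open>C\<close> below ever lower vertices, which cannot go on in a finite tree.\<close>

lemma no_alternating_component:
  assumes C: "alternating_component R C"
    and order: "(\<forall>(a, b)\<in>C. before a b) \<or> (\<forall>(a, b)\<in>C. \<not> before a b)"
    and pair: "\<And>a b. (a, b) \<in> C \<Longrightarrow> (a, b) \<notin> R \<and> (a0, b) \<in> R \<and> exit a (e a) \<and> b \<in> X"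
    and side: "(\<forall>(a, b)\<in>C. b \<notin> desc (e a)) \<or> (\<forall>(a, b)\<in>C. b \<in> right_of (e a)) \<or>
      (\<forall>(a, b)\<in>C. b \<in> left_of (e a))"
  shows False
proof -
  have same: "\<exists>c\<in>children v. a \<in> desc c \<and> b' \<in> desc c"
    if v: "\<And>a b. (a, b) \<in> C \<Longrightarrow> a \<in> desc v \<and> b \<in> desc v"
      and ab: "(a, b) \<in> C" "(a', b') \<in> C" "(a, b') \<in> R" for v a b a' b'
  proof (cases "\<exists>x y. (x, y) \<in> C \<and> v \<in> desc (e x)")
    case True
    then obtain x y where xy: "(x, y) \<in> C" "v \<in> desc (e x)" by blast
    from side show ?thesis
    proof (elim disjE)
      \<comment> \<open>Impossible here, as \<open>y\<close> descends from \<open>v\<close> and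
        \<open>v\<close> from \<open>e x\<close>.\<close>
      assume "\<forall>(a, b)\<in>C. b \<notin> desc (e a)"
      then show ?thesis using v[OF xy(1)] xy desc_trans by blast
    next
      assume "\<forall>(a, b)\<in>C. b \<in> right_of (e a)"
      then interpret right_cycle X R a0 l r p idx C e
        by unfold_locales (use C pair in auto)
      show ?thesis using same_child_right[OF v xy ab] .
    next
      assume *: "\<forall>(a, b)\<in>C. b \<in> left_of (e a)"
      interpret mirror: gated_poset X R a0 r l p idx by (rule mirror)
      interpret mirror: right_cycle X R a0 r l p idx C e
        by unfold_locales (use C pair * in \<open>auto simp: mirror_exit mirror_right_of\<close>)
      show ?thesis using mirror.same_child_right[OF v xy ab] .
    qed
  next
    case False
    \<comment> \<open>No exit vertex is \<open>v\<close> or an ancestor of \<open>v\<close>, so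
      \<open>e a\<close> lies below a child of \<open>v\<close> and confines everything above
      \<open>a\<close> to that child.\<close>
    have a: "a \<in> desc (e a)" using pair[OF ab(1)] by (simp add: exit_def)
    then have "e a \<in> desc v" "e a \<noteq> v"
      using desc_comparable[OF a, of v] v[OF ab(1)] False ab(1) desc_base desc_self by blast+
    then obtain c where c: "c \<in> children v" "e a \<in> desc c" by (rule desc_childE)
    moreover have "b' \<in> desc (e a)" using exit_confined pair[OF ab(1)] ab(3) by blast
    ultimately show ?thesis using a desc_trans by blast
  qed
  have "False" if "v \<in> X" "\<And>a b. (a, b) \<in> C \<Longrightarrow> a \<in> desc v \<and> b \<in> desc v" for v
    using that
  proof (induction "card (desc v)" arbitrary: v rule: less_induct)
    case less
    have step: "\<exists>c\<in>children v. a \<in> desc c \<and> b' \<in> desc c"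
      if "(a, b) \<in> C" "(a', b') \<in> C" "(a, b') \<in> R" for a b a' b'
      using same[of v, OF _ that] less.prems(2) by blast
    have "\<exists>c\<in>children v. \<forall>(a, b)\<in>C. a \<in> desc c \<and> b \<in> desc c"
      by (rule children_of_component[OF C order]) (rule step)
    then obtain c where c: "c \<in> children v" "\<forall>(a, b)\<in>C. a \<in> desc c \<and> b \<in> desc c"
      by blast
    have "finite (desc v)" using fin by (simp add: desc_def)
    moreover have "desc c \<subset> desc v"
      using desc_child_subset[OF c(1)] not_in_desc_child[OF c(1)] desc_self[OF less.prems(1)] by blast
    ultimately have "card (desc c) < card (desc v)" by (rule psubset_card_mono)
    then show False using less.hyps[of c] c by (auto simp: children_def)
  qed
  moreover have "a \<in> desc a0 \<and> b \<in> desc a0" if "(a, b) \<in> C" for a b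
    using pair[OF that] desc_root desc_subset by (auto simp: exit_def)
  ultimately show False using a0 by blast
qed

text \<open>Two branching orders and three sides make six classes; parts of larger index are
  empty.\<close>

theorem partitionable_into_6:
  assumes M: "M \<subseteq> incomparable_pairs X R" and n: "6 \<le> n"
    and pair: "\<And>a b. (a, b) \<in> M \<Longrightarrow> (a, a0) \<notin> R \<and> (a0, b) \<in> R"
  shows "partitionable_into_reversible X R M n"
proof -
  have MX: "a \<in> X \<and> b \<in> X \<and> (a, b) \<notin> R" if "(a, b) \<in> M" for a b
    using M that by (auto simp: incomparable_pairs_def)
  define e where "e a = (SOME u. exit a u)" for a
  have e: "exit a (e a)" if "(a, b) \<in> M" for a b
    unfolding e_def using ex_exit pair[OF that] MX[OF that] by (metis someI_ex)
  define side :: "'a \<Rightarrow> 'a \<Rightarrow> nat" where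
    "side a b = (if b \<notin> desc (e a) then 0 else if b \<in> right_of (e a) then 1 else 2)" for a b
  \<comment> \<open>The quotient by 3 recovers the branching order, the remainder the side.\<close>
  define cls where "cls a b = 3 * of_bool (before a b) + side a b" for a b
  define I where "I k = {(a, b) \<in> M. cls a b = k}" for k
  have side3: "side a b < 3" for a b by (simp add: side_def)
  have left: "b \<in> left_of (e a)" if "(a, b) \<in> M" "side a b = 2" for a b
  proof -
    have "b \<in> desc (e a)" "b \<notin> right_of (e a)" using that(2) by (auto simp: side_def split: if_splits)
    moreover have "b \<noteq> e a" using exit_above[OF e[OF that(1)]] MX[OF that(1)] by auto
    ultimately show ?thesis using desc_cases e[OF that(1)] by (auto simp: exit_def)
  qed
  have "reversible X R (I k)" for k
  proof (rule reversible_if_acyclic_alternation[OF fin po])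
    show "I k \<subseteq> incomparable_pairs X R" using M by (auto simp: I_def)
    show "acyclic (alternation R (I k))"
    proof (rule ccontr)
      assume "\<not> ?thesis"
      then obtain C where C: "C \<subseteq> I k" "alternating_component R C"
        by (rule ex_alternating_component)
      have cls: "of_bool (before a b) = k div 3 \<and> side a b = k mod 3 \<and> (a, b) \<in> M" if "(a, b) \<in> C" for a b
        using C(1) that side3[of a b] by (auto simp: I_def cls_def)
      have "(\<forall>(a, b)\<in>C. before a b) \<or> (\<forall>(a, b)\<in>C. \<not> before a b)"
        using cls by (cases "k div 3 = 0") fastforce+
      moreover have "(\<forall>(a, b)\<in>C. b \<notin> desc (e a)) \<or> (\<forall>(a, b)\<in>C. b \<in> right_of (e a)) \<or>
        (\<forall>(a, b)\<in>C. b \<in> left_of (e a))"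
      proof -
        consider "k mod 3 = 0" | "k mod 3 = 1" | "k mod 3 = 2" by linarith
        then show ?thesis
        proof cases
          case 1
          then show ?thesis using cls by (fastforce simp: side_def split: if_splits)
        next
          case 2
          then show ?thesis using cls by (fastforce simp: side_def split: if_splits)
        next
          case 3
          then show ?thesis using cls left by fastforce
        qed
      qed
      ultimately show False
        using no_alternating_component[OF C(2), of e] cls pair MX e by blast
    qed
  qed
  moreover have "disjoint_family_on I {..<n}" by (auto simp: disjoint_family_on_def I_def)
  moreover have "(\<Union>k<n. I k) = M"
  proof -
    have "cls a b < n" for a b using side3[of a b] n by (auto simp: cls_def)
    then show ?thesis by (auto simp: I_def)
  qed
  ultimately show ?thesis unfolding partitionable_into_reversible_def by blast
qed

end

section \<open>Gates of the cover graph and conclusion\<close>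

theorem theorem2:
  fixes X :: "'a set" and R :: "'a rel" and a\<^sub>0 :: 'a
  assumes "finite X" and "partial_order_on X R"
    and "treewidth (cover_graph X R) \<le> 2"
    and "a\<^sub>0 \<in> min_elements X R"
    and "\<forall>b\<in>max_elements X R. strictly_below R a\<^sub>0 b"
  shows "partitionable_into_reversible X R (min_max_pairs X R) 638"
proof -
  let ?G = "cover_graph X R"
  interpret G: pair_graph ?G by (rule pair_graph_cover_graph) fact
  have V: "pverts ?G = X" by (simp add: cover_graph_def)
  have a0: "a\<^sub>0 \<in> X" using assms(4) by (simp add: min_elements_def)
  obtain T :: "nat pair_pre_digraph" and S where "tree_decomposition ?G T S 2"
    using treewidth_le_iff[of ?G 2] assms(1,3) V G.pair_wf_digraph by auto
  \<comment> \<open>The order starts at \<open>a\<^sub>0\<close>, which makes it the root of the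
    gated poset.\<close>
  then obtain idx N where ord: "elimination_order ?G 2 a\<^sub>0 idx N"
    using tree_decomposition_elimination_order[of ?G T S 2 a\<^sub>0] assms(1) a0 V by auto
  then have idx: "inj_on idx X" "\<forall>x\<in>X. idx a\<^sub>0 \<le> idx x"
    and N: "\<forall>y\<in>X. N y \<subseteq> {x \<in> X. idx x < idx y}"
    and edge: "\<forall>x\<in>X. \<forall>y\<in>X. (x, y) \<in> parcs ?G \<longrightarrow> idx x < idx y \<longrightarrow> x \<in> N y"
    unfolding elimination_order_def V by blast+
  obtain l r p where lrp: "l a\<^sub>0 = a\<^sub>0" "r a\<^sub>0 = a\<^sub>0"
    "\<forall>v\<in>X - {a\<^sub>0}. p v \<in> X \<and> idx (p v) < idx v \<and> N v \<subseteq> {l v, r v} \<and>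
      (l v = l (p v) \<and> r v = p v \<or> l v = p v \<and> r v = r (p v))"
    using ex_gates[OF ord] assms(1) unfolding V by blast
  have N_gates: "x \<in> {l y, r y}" if "x \<in> N y" "y \<in> X" for x y
  proof -
    have "y \<noteq> a\<^sub>0" using N that idx(2) by fastforce
    then show ?thesis using lrp(3) that by blast
  qed
  interpret gated_poset X R a\<^sub>0 l r p idx
  proof
    fix x y assume cov: "covered_by X R x y"
    then have xy: "x \<in> X" "y \<in> X" "x \<noteq> y" "(x, y) \<in> parcs ?G" "(y, x) \<in> parcs ?G"
      by (auto simp: covered_by_def strictly_below_def cover_graph_def)
    then have "idx x < idx y \<or> idx y < idx x" using idx(1) by (meson inj_onD linorder_neqE_nat)
    then show "x \<in> {l y, r y} \<or> y \<in> {l x, r x}" using edge xy N_gates by blast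
  qed (use assms(1,2) a0 idx(1) lrp in auto)
  show ?thesis
  proof (rule partitionable_into_6)
    show "min_max_pairs X R \<subseteq> incomparable_pairs X R" by (auto simp: min_max_pairs_def)
    fix a b assume "(a, b) \<in> min_max_pairs X R"
    then have ab: "a \<in> X" "(a, b) \<notin> R" "b \<in> max_elements X R"
      by (auto simp: min_max_pairs_def incomparable_pairs_def)
    then have a0b: "(a\<^sub>0, b) \<in> R" using assms(5) by (auto simp: strictly_below_def)
    then have "a \<noteq> a\<^sub>0" using ab by auto
    \<comment> \<open>Nothing but \<open>a\<^sub>0\<close> itself lies below the minimal element
      \<open>a\<^sub>0\<close>.\<close>
    then show "(a, a\<^sub>0) \<notin> R \<and> (a\<^sub>0, b) \<in> R"
      using assms(4) ab(1) a0b by (auto simp: min_elements_def strictly_below_def)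
  qed simp
qed

end
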